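(* Let $p$ be an odd prime, $\chi$ a Dirichlet character modulo $p^v$ with $v\ge1$, $x\in\mathbb Z_p$, and $s\in\mathbb C_p$ with $|s|_p<R_p=p^{(p-2)/(p-1)}$. Then $$\int_{\mathbb Z_p}\zeta_{p,E}(\chi,s,x+a)\,d\mu_{-1}(a)=2(1-x)\,\zeta_{p,E}(\chi,s,x)+2\,\zeta_{p,E}(\chi\omega,s-1,x).$$
   Context: $p$ is an odd prime. For $f:\mathbb Z_p\to\mathbb C_p$ uniformly differentiable, $\int_{\mathbb Z_p}f(a)\,d\mu_{-1}(a)=\lim_{N\to\infty}\sum_{a=0}^{p^N-1}(-1)^af(a)$. The Teichmüller character $\omega$: for $y\in\mathbb Z_p^\times$, $\omega(y)$ is the $(p-1)$-th root of unity with $\omega(y)\equiv y\pmod p$, $\omega(y)=0$ if $p\mid y$; it is a Dirichlet character modulo $p$. For $y\in\mathbb Z_p^\times$, $\langle y\rangle=y/\omega(y)$, and $\langle y\rangle^t=\sum_{k\ge0}\binom tk(\langle y\rangle-1)^k$ for $|t|_p<R_p$. A Dirichlet character $\chi$ modulo $p^v$ is extended to $\mathbb Z_p$ by $\chi(y)=\chi(n)$ for any integer $n\equiv y\pmod{p^v}$ (so $\chi(y)=0$ if $p\mid y$). For $x\in\mathbb Z_p$, $\zeta_{p,E}(\chi,s,x)=\int_{\mathbb Z_p}\chi(x+a)\langle x+a\rangle^{1-s}\,d\mu_{-1}(a)$, the integrand being $0$ where $\chi(x+a)=0$. *)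

theory Defs
  imports "HOL-Analysis.Analysis" "HOL-Computational_Algebra.Computational_Algebra"
begin

class nonarch_valued_field = field_char_0 + metric_space +
  fixes vabs :: "'a \<Rightarrow> real"
  assumes dist_vabs: "dist x y = vabs (x - y)"
    and vabs_mult: "vabs (x * y) = vabs x * vabs y"
    and vabs_add_le_max: "vabs (x + y) \<le> max (vabs x) (vabs y)"

text \<open>
  In a complete extension of \<open>\<rat>\<close> with \<open>\<bar>p\<bar> = 1/p\<close>, the closure of the prime field is the completion
  of \<open>\<rat>\<close> for the \<open>p\<close>-adic absolute value. The prime \<open>p\<close> is thus carried by the absolute value and
  is not an argument of the following sets.
\<close>

definition padic_numbers :: "'a::nonarch_valued_field set" where
  "padic_numbers = closure (range of_rat)"

definition padic_integers :: "'a::nonarch_valued_field set" where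
  "padic_integers = {x \<in> padic_numbers. vabs x \<le> 1}"

definition padic_units :: "'a::nonarch_valued_field set" where
  "padic_units = {x \<in> padic_integers. inverse x \<in> padic_integers \<and> x \<noteq> 0}"

definition padic_algebraic :: "'a::nonarch_valued_field set" where
  "padic_algebraic =
     {x. \<exists>q. q \<noteq> 0 \<and> (\<forall>i. coeff q i \<in> padic_numbers) \<and> poly q x = 0}"

text \<open>
  The type \<open>'a\<close> is a completion of an algebraic closure of \<open>\<rat>\<^sub>p\<close>: it is complete (by its sort), its
  absolute value restricts to the normalised \<open>p\<close>-adic one, the elements algebraic over \<open>\<rat>\<^sub>p\<close>
  form an algebraically closed field, and they are dense. This determines \<open>\<complex>\<^sub>p\<close> up to isometric
  isomorphism.
\<close>

definition padic_complex_field ::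
    "nat \<Rightarrow> 'a::{nonarch_valued_field, complete_space} itself \<Rightarrow> bool" where
  "padic_complex_field p (_ :: 'a itself) \<longleftrightarrow>
     vabs (of_nat p :: 'a) = 1 / real p \<and>
     (\<forall>q :: 'a poly. degree q > 0 \<longrightarrow> (\<forall>i. coeff q i \<in> padic_algebraic) \<longrightarrow>
        (\<exists>z \<in> padic_algebraic. poly q z = 0)) \<and>
     closure (padic_algebraic :: 'a set) = UNIV"

definition padic_cong :: "nat \<Rightarrow> 'a::nonarch_valued_field \<Rightarrow> 'a \<Rightarrow> bool" where
  "padic_cong m y z \<longleftrightarrow> (\<exists>w \<in> padic_integers. y - z = of_nat m * w)"

text \<open>
  The integral against \<open>\<mu>\<^sub>-\<^sub>1\<close>; only the values of the integrand on \<open>\<int>\<^sub>p\<close> (indeed on \<open>\<nat>\<close>) matter.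
\<close>

definition fermionic_sum ::
    "nat \<Rightarrow> ('a::nonarch_valued_field \<Rightarrow> 'a) \<Rightarrow> nat \<Rightarrow> 'a" where
  "fermionic_sum p f N = (\<Sum>a<p ^ N. (- 1) ^ a * f (of_nat a))"

definition fermionic_integrable ::
    "nat \<Rightarrow> ('a::nonarch_valued_field \<Rightarrow> 'a) \<Rightarrow> bool" where
  "fermionic_integrable p f \<longleftrightarrow> convergent (fermionic_sum p f)"

definition fermionic_integral ::
    "nat \<Rightarrow> ('a::nonarch_valued_field \<Rightarrow> 'a) \<Rightarrow> 'a" where
  "fermionic_integral p f = lim (fermionic_sum p f)"

definition teichmueller :: "nat \<Rightarrow> 'a::nonarch_valued_field \<Rightarrow> 'a" where
  "teichmueller p y =
     (if y \<in> padic_units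
      then THE z. z \<in> padic_integers \<and> z ^ (p - 1) = 1 \<and> padic_cong p z y
      else 0)"

definition padic_angle :: "nat \<Rightarrow> 'a::nonarch_valued_field \<Rightarrow> 'a" where
  "padic_angle p y = y / teichmueller p y"

definition padic_angle_power ::
    "nat \<Rightarrow> 'a::nonarch_valued_field \<Rightarrow> 'a \<Rightarrow> 'a" where
  "padic_angle_power p y t = (\<Sum>k. (t gchoose k) * (padic_angle p y - 1) ^ k)"

definition zeta_radius :: "nat \<Rightarrow> real" where
  "zeta_radius p = real p powr ((real p - 2) / (real p - 1))"

definition dirichlet_character :: "nat \<Rightarrow> (int \<Rightarrow> 'a::field) \<Rightarrow> bool" where
  "dirichlet_character m chi \<longleftrightarrow>
     (\<forall>a b. chi (a * b) = chi a * chi b) \<and>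
     (\<forall>a. chi (a + int m) = chi a) \<and>
     (\<forall>a. chi a = 0 \<longleftrightarrow> \<not> coprime a (int m))"

text \<open>For \<open>chi\<close> of period \<open>m = p ^ v\<close> the value does not depend on the integer chosen.\<close>

definition character_extension ::
    "nat \<Rightarrow> (int \<Rightarrow> 'a::nonarch_valued_field) \<Rightarrow> 'a \<Rightarrow> 'a" where
  "character_extension m chi y = chi (SOME n. padic_cong m (of_int n) y)"

definition teichmueller_character :: "nat \<Rightarrow> int \<Rightarrow> 'a::nonarch_valued_field" where
  "teichmueller_character p n = teichmueller p (of_int n)"

text \<open>
  Here \<open>chi\<close> is a character modulo \<open>p ^ v\<close>. Where \<open>chi(x + a) = 0\<close> the integrand is \<open>0\<close> whatever
  value the second factor takes there.
\<close>

definition zeta_pE ::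
    "nat \<Rightarrow> nat \<Rightarrow> (int \<Rightarrow> 'a::nonarch_valued_field) \<Rightarrow> 'a \<Rightarrow> 'a \<Rightarrow> 'a" where
  "zeta_pE p v chi s x =
     fermionic_integral p
       (\<lambda>a. character_extension (p ^ v) chi (x + a) * padic_angle_power p (x + a) (1 - s))"

end

theory Submission
  imports Defs "HOL-Number_Theory.Residues"
begin

text \<open>
  Write \<open>f y = \<chi>(y)\<langle>y\<rangle>\<^sup>1\<^sup>-\<^sup>s\<close> and let \<open>F x\<close> be the integral of \<open>f (x + a)\<close> over \<open>a\<close>, the zeta function.
  On residue classes modulo \<open>p\<^sup>v\<close> the character is constant and the binomial series is Lipschitz,
  so \<open>f\<close> is uniformly continuous on \<open>\<int>\<^sub>p\<close>; since \<open>p\<close> is odd, consecutive partial sums of the integral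
  then become arbitrarily close, which for an ultrametric is convergence. The functional equation
  \<open>F (x + 1) + F x = 2 f x\<close> expresses the partial sums of the integral of \<open>F (x + b)\<close> by those of
  \<open>f (x + a)\<close> and \<open>a f (x + a)\<close>, and letting \<open>p\<^sup>N\<close> tend to \<open>0\<close> yields \<open>2 (1 - x) F x\<close> plus twice the
  integral of \<open>(x + a) f (x + a)\<close>. Finally \<open>y = \<omega>(y)\<langle>y\<rangle>\<close> turns \<open>y f y\<close> into \<open>(\<chi>\<omega>)(y)\<langle>y\<rangle>\<^sup>2\<^sup>-\<^sup>s\<close>.
\<close>

section \<open>Ultrametric absolute values\<close>

lemma vabs_eq_dist: "vabs (x :: 'a::nonarch_valued_field) = dist x 0"
  by (simp add: dist_vabs)

lemma vabs_nonneg [simp]: "0 \<le> vabs (x :: 'a::nonarch_valued_field)"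
  by (simp add: vabs_eq_dist)

lemma vabs_eq_0_iff [simp]: "vabs (x :: 'a::nonarch_valued_field) = 0 \<longleftrightarrow> x = 0"
  by (simp add: vabs_eq_dist)

lemma vabs_0 [simp]: "vabs (0 :: 'a::nonarch_valued_field) = 0"
  by simp

lemma vabs_1 [simp]: "vabs (1 :: 'a::nonarch_valued_field) = 1"
proof -
  have "vabs (1::'a) * vabs (1::'a) = vabs (1::'a)"
    by (simp flip: vabs_mult)
  then show ?thesis
    by simp
qed

lemma vabs_minus_commute: "vabs (x - y) = vabs (y - x :: 'a::nonarch_valued_field)"
  by (metis dist_commute dist_vabs)

lemma vabs_minus [simp]: "vabs (- x) = vabs (x :: 'a::nonarch_valued_field)"
  using vabs_minus_commute[of 0 x] by simp

lemma vabs_add_le: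
  "vabs x \<le> B \<Longrightarrow> vabs y \<le> B \<Longrightarrow> vabs (x + y :: 'a::nonarch_valued_field) \<le> B"
  using vabs_add_le_max[of x y] by linarith

lemma vabs_diff_le:
  "vabs x \<le> B \<Longrightarrow> vabs y \<le> B \<Longrightarrow> vabs (x - y :: 'a::nonarch_valued_field) \<le> B"
  using vabs_add_le[of x B "- y"] by simp

lemma vabs_diff_trans:
  "vabs (x - y) \<le> B \<Longrightarrow> vabs (y - z) \<le> B \<Longrightarrow> vabs (x - z :: 'a::nonarch_valued_field) \<le> B"
  using vabs_add_le[of "x - y" B "y - z"] by simp

lemma vabs_power: "vabs (x ^ n) = vabs (x :: 'a::nonarch_valued_field) ^ n"
  by (induction n) (simp_all add: vabs_mult)

lemma vabs_inverse: "vabs (inverse x) = inverse (vabs (x :: 'a::nonarch_valued_field))"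
proof (cases "x = 0")
  case False
  then have "vabs x * vabs (inverse x) = 1"
    by (simp flip: vabs_mult)
  then show ?thesis
    by (simp add: inverse_unique)
qed simp

lemma vabs_divide: "vabs (x / y) = vabs x / vabs (y :: 'a::nonarch_valued_field)"
  by (simp add: divide_inverse vabs_mult vabs_inverse)

lemma vabs_sum_le:
  assumes "0 \<le> B" "\<And>i. i \<in> A \<Longrightarrow> vabs (f i :: 'a::nonarch_valued_field) \<le> B"
  shows "vabs (sum f A) \<le> B"
  using assms(2) by (induction A rule: infinite_finite_induct) (simp_all add: vabs_add_le assms(1))

lemma vabs_prod: "vabs (prod f A) = (\<Prod>i\<in>A. vabs (f i :: 'a::nonarch_valued_field))"
  by (induction A rule: infinite_finite_induct) (simp_all add: vabs_mult)

lemma vabs_of_nat_le_1: "vabs (of_nat n :: 'a::nonarch_valued_field) \<le> 1"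
  by (induction n) (simp_all add: vabs_add_le)

lemma vabs_of_int_le_1: "vabs (of_int n :: 'a::nonarch_valued_field) \<le> 1"
  by (cases n) (simp_all add: vabs_of_nat_le_1 del: of_nat_Suc)

text \<open>The isosceles principle: in \<open>y = (y - x) + x\<close> the maximum cannot be
  attained by the difference, which is strictly smaller than \<open>y\<close>.\<close>

lemma vabs_eq_of_diff_less:
  assumes "vabs (x - y) < vabs (y :: 'a::nonarch_valued_field)"
  shows "vabs x = vabs y"
proof (rule antisym)
  show "vabs x \<le> vabs y"
    using vabs_add_le[of "x - y" "vabs y" y] assms by simp
  show "vabs y \<le> vabs x"
    using vabs_add_le_max[of "y - x" x] assms by (simp add: vabs_minus_commute)
qed

text \<open>Dividing by \<open>z - w\<close> leaves a sum of \<open>n\<close> monomials of degree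
  \<open>n - 1\<close>, and an ultrametric sum is no larger than its largest term. For
  \<open>n = 0\<close> the left side vanishes.\<close>

lemma vabs_power_diff_le:
  fixes z w :: "'a::nonarch_valued_field"
  assumes "vabs z \<le> r" "vabs w \<le> r"
  shows "vabs (z ^ n - w ^ n) \<le> vabs (z - w) * r ^ (n - 1)"
proof -
  have r: "0 \<le> r"
    using assms(1) vabs_nonneg order_trans by blast
  have "vabs (w ^ (n - Suc i) * z ^ i) \<le> r ^ (n - 1)" if "i < n" for i
  proof -
    have "vabs (w ^ (n - Suc i) * z ^ i) \<le> r ^ (n - Suc i) * r ^ i"
      unfolding vabs_mult vabs_power using assms r by (intro mult_mono power_mono) auto
    also have "\<dots> = r ^ (n - 1)"
      using that by (simp flip: power_add)
    finally show ?thesis .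
  qed
  then have "vabs (\<Sum>i<n. w ^ (n - Suc i) * z ^ i) \<le> r ^ (n - 1)"
    using r by (intro vabs_sum_le) auto
  then show ?thesis
    by (simp add: power_diff_sumr2 vabs_mult mult_left_mono)
qed

section \<open>The topology of a valued field\<close>

lemma tendsto_vabs_diff_iff:
  "(f \<longlongrightarrow> (l :: 'a::nonarch_valued_field)) F \<longleftrightarrow> ((\<lambda>x. vabs (f x - l)) \<longlongrightarrow> 0) F"
  by (subst tendsto_dist_iff) (simp add: dist_vabs)

lemma tendsto_vabs_bound:
  assumes "\<forall>\<^sub>F x in F. vabs (f x - l :: 'a::nonarch_valued_field) \<le> g x" "(g \<longlongrightarrow> 0) F"
  shows "(f \<longlongrightarrow> l) F"
  unfolding tendsto_vabs_diff_iff
  by (rule tendsto_sandwich[OF _ assms(1) tendsto_const assms(2)]) simp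

text \<open>This instance, together with the one for multiplication below, makes the generic limit
  rules for sums, differences and products available.\<close>

instance nonarch_valued_field < topological_ab_group_add
proof
  fix a b :: 'a
  let ?F = "nhds a \<times>\<^sub>F nhds b"
  have lim: "((\<lambda>z. vabs (fst z - a)) \<longlongrightarrow> 0) ?F" "((\<lambda>z. vabs (snd z - b)) \<longlongrightarrow> 0) ?F"
    by (simp_all add: filterlim_fst filterlim_snd flip: tendsto_vabs_diff_iff)
  show "((\<lambda>z. fst z + snd z) \<longlongrightarrow> a + b) ?F"
  proof (rule tendsto_vabs_bound[OF always_eventually])
    show "((\<lambda>z. vabs (fst z - a) + vabs (snd z - b)) \<longlongrightarrow> 0) ?F"
      using tendsto_add[OF lim] by simp
    show "\<forall>z. vabs (fst z + snd z - (a + b)) \<le> vabs (fst z - a) + vabs (snd z - b)"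
    proof
      fix z :: "'a \<times> 'a"
      have "vabs ((fst z - a) + (snd z - b)) \<le> max (vabs (fst z - a)) (vabs (snd z - b))"
        by (rule vabs_add_le_max)
      also have "\<dots> \<le> vabs (fst z - a) + vabs (snd z - b)"
        by simp
      finally show "vabs (fst z + snd z - (a + b)) \<le> vabs (fst z - a) + vabs (snd z - b)"
        by (simp only: add_diff_add)
    qed
  qed
  show "(uminus \<longlongrightarrow> - a) (nhds a)"
  proof (rule tendsto_vabs_bound[OF always_eventually])
    show "((\<lambda>z. vabs (z - a)) \<longlongrightarrow> 0) (nhds a)"
      by (simp add: filterlim_ident flip: tendsto_vabs_diff_iff)
    show "\<forall>z. vabs (- z - - a) \<le> vabs (z - a)"
      by (simp add: vabs_minus_commute)
  qed
qed

lemma tendsto_vabs [tendsto_intros]: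
  "(f \<longlongrightarrow> (l :: 'a::nonarch_valued_field)) F \<Longrightarrow> ((\<lambda>x. vabs (f x)) \<longlongrightarrow> vabs l) F"
  unfolding vabs_eq_dist by (rule tendsto_dist[OF _ tendsto_const])

instance nonarch_valued_field < topological_comm_monoid_mult
proof
  fix a b :: 'a
  let ?F = "nhds a \<times>\<^sub>F nhds b"
  have fst: "(fst \<longlongrightarrow> a) ?F" and snd: "(snd \<longlongrightarrow> b) ?F"
    by (simp_all add: filterlim_fst filterlim_snd)
  have lim: "((\<lambda>z. vabs (fst z - a)) \<longlongrightarrow> 0) ?F" "((\<lambda>z. vabs (snd z - b)) \<longlongrightarrow> 0) ?F"
    using fst snd by (simp_all flip: tendsto_vabs_diff_iff)
  show "((\<lambda>z. fst z * snd z) \<longlongrightarrow> a * b) ?F"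
  proof (rule tendsto_vabs_bound[OF always_eventually])
    show "((\<lambda>z. vabs (fst z - a) * vabs (snd z) + vabs a * vabs (snd z - b)) \<longlongrightarrow> 0) ?F"
      using tendsto_add[OF tendsto_mult[OF lim(1) tendsto_vabs[OF snd]]
          tendsto_mult[OF tendsto_const lim(2)]] by simp
    show "\<forall>z. vabs (fst z * snd z - a * b)
        \<le> vabs (fst z - a) * vabs (snd z) + vabs a * vabs (snd z - b)"
    proof
      fix z :: "'a \<times> 'a"
      have "fst z * snd z - a * b = (fst z - a) * snd z + a * (snd z - b)"
        by (simp add: algebra_simps)
      then show "vabs (fst z * snd z - a * b)
          \<le> vabs (fst z - a) * vabs (snd z) + vabs a * vabs (snd z - b)"
        using vabs_add_le_max[of "(fst z - a) * snd z" "a * (snd z - b)"] unfolding vabs_mult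
        by (smt (verit) mult_nonneg_nonneg vabs_nonneg)
    qed
  qed
qed

text \<open>The difference of the inverses is \<open>(l - f x) / (f x * l)\<close>, whose
  denominator stays away from \<open>0\<close> near the limit.\<close>

lemma tendsto_inverse_valued:
  fixes l :: "'a::nonarch_valued_field"
  assumes f: "(f \<longlongrightarrow> l) F" and "l \<noteq> 0"
  shows "((\<lambda>x. inverse (f x)) \<longlongrightarrow> inverse l) F"
proof (rule tendsto_vabs_bound)
  have "\<forall>\<^sub>F x in F. f x \<noteq> 0"
    using tendsto_imp_eventually_ne[OF f \<open>l \<noteq> 0\<close>] .
  then show "\<forall>\<^sub>F x in F. vabs (inverse (f x) - inverse l) \<le> vabs (f x - l) / (vabs (f x) * vabs l)"
  proof eventually_elim
    case (elim x)
    then have "inverse (f x) - inverse l = (l - f x) / (f x * l)"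
      using \<open>l \<noteq> 0\<close> by (simp add: field_simps)
    then show ?case
      by (simp add: vabs_divide vabs_mult vabs_minus_commute)
  qed
  have "((\<lambda>x. vabs (f x - l)) \<longlongrightarrow> 0) F"
    using f by (simp flip: tendsto_vabs_diff_iff)
  from tendsto_divide[OF this tendsto_mult[OF tendsto_vabs[OF f] tendsto_const]]
  show "((\<lambda>x. vabs (f x - l) / (vabs (f x) * vabs l)) \<longlongrightarrow> 0) F"
    using \<open>l \<noteq> 0\<close> by fastforce
qed

lemma vabs_limit_le:
  assumes "X \<longlonglongrightarrow> (l :: 'a::nonarch_valued_field)" "\<And>n. vabs (X n) \<le> B"
  shows "vabs l \<le> B"
  by (rule LIMSEQ_le_const2[OF tendsto_vabs[OF assms(1)]]) (simp add: assms(2))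

text \<open>The distance between two terms is at most the largest step between consecutive ones, so
  vanishing steps already make a sequence Cauchy.\<close>

lemma convergent_ultrametric:
  fixes X :: "nat \<Rightarrow> 'a::{nonarch_valued_field, complete_space}"
  assumes "(\<lambda>n. vabs (X (Suc n) - X n)) \<longlonglongrightarrow> 0"
  shows "convergent X"
proof -
  have "Cauchy X"
  proof (rule metric_CauchyI)
    fix e :: real assume e: "0 < e"
    then obtain M where "\<forall>n\<ge>M. norm (vabs (X (Suc n) - X n) - 0) < e / 2"
      using LIMSEQ_D[OF assms, of "e / 2"] by auto
    then have M: "vabs (X (Suc n) - X n) < e / 2" if "n \<ge> M" for n
      using that by simp
    \<comment> \<open>Steps do not accumulate: the same bound survives the induction. Half of
      \<open>e\<close> leaves room to return to a strict inequality.\<close>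
    have "vabs (X n - X M) \<le> e / 2" if "n \<ge> M" for n
      using that
    proof (induction n rule: dec_induct)
      case (step n)
      have "vabs (X (Suc n) - X n) \<le> e / 2"
        using M[of n] step.hyps by simp
      then show ?case
        using step.IH by (rule vabs_diff_trans)
    qed (use e in auto)
    then have "vabs (X m - X n) \<le> e / 2" if "m \<ge> M" "n \<ge> M" for m n
      using that vabs_minus_commute[of "X M" "X n"] vabs_diff_trans[of "X m" "X M" "e / 2" "X n"]
      by presburger
    then have "dist (X m) (X n) \<le> e / 2" if "m \<ge> M" "n \<ge> M" for m n
      unfolding dist_vabs using that by blast
    moreover have "e / 2 < e"
      using e by simp
    ultimately show "\<exists>M. \<forall>m\<ge>M. \<forall>n\<ge>M. dist (X m) (X n) < e"
      by (intro exI[of _ M] allI impI) (rule le_less_trans)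
  qed
  then show ?thesis
    by (rule Cauchy_convergent)
qed

lemma summable_ultrametric:
  fixes f :: "nat \<Rightarrow> 'a::{nonarch_valued_field, complete_space}"
  assumes "(\<lambda>n. vabs (f n)) \<longlonglongrightarrow> 0"
  shows "summable f"
proof -
  have "convergent (\<lambda>n. \<Sum>i<n. f i)"
    by (rule convergent_ultrametric) (simp add: assms)
  then show ?thesis
    by (simp only: summable_iff_convergent)
qed

section \<open>The p-adic numbers in a valued field\<close>

text \<open>With elements presented as limits of rational sequences, closure under the field
  operations follows by operating termwise.\<close>

lemma padic_numbers_sequence:
  "x \<in> padic_numbers \<longleftrightarrow> (\<exists>X. (\<lambda>n. of_rat (X n)) \<longlonglongrightarrow> (x :: 'a::nonarch_valued_field))"
  unfolding padic_numbers_def closure_sequential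
proof safe
  fix X assume X: "\<forall>n. X n \<in> range of_rat" "X \<longlonglongrightarrow> x"
  then have "\<forall>n. \<exists>q. X n = of_rat q"
    by blast
  then obtain Y where "\<forall>n. X n = of_rat (Y n)"
    by (rule choice[THEN exE])
  then have "X = (\<lambda>n. of_rat (Y n))"
    by (simp add: fun_eq_iff)
  with X(2) show "\<exists>Y. (\<lambda>n. of_rat (Y n)) \<longlonglongrightarrow> x"
    by (intro exI[of _ Y]) simp
next
  fix X assume "(\<lambda>n. of_rat (X n)) \<longlonglongrightarrow> x"
  then show "\<exists>Y. (\<forall>n. Y n \<in> range of_rat) \<and> Y \<longlonglongrightarrow> x"
    by (intro exI[of _ "\<lambda>n. of_rat (X n)"]) simp
qed

lemma padic_numbers_of_int [simp]: "(of_int n :: 'a::nonarch_valued_field) \<in> padic_numbers"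
proof -
  have "of_rat (of_int n) \<in> closure (range (of_rat :: rat \<Rightarrow> 'a))"
    by (intro subsetD[OF closure_subset] rangeI)
  then show ?thesis
    by (simp add: padic_numbers_def)
qed

lemma padic_numbers_of_nat [simp]: "of_nat n \<in> padic_numbers"
  using padic_numbers_of_int[of "int n"] by simp

lemma padic_numbers_1 [simp]: "1 \<in> padic_numbers"
  using padic_numbers_of_int[of 1] by simp

lemma padic_numbers_add: "x \<in> padic_numbers \<Longrightarrow> y \<in> padic_numbers \<Longrightarrow> x + y \<in> padic_numbers"
  unfolding padic_numbers_sequence
proof safe
  fix X Y assume "(\<lambda>n. of_rat (X n)) \<longlonglongrightarrow> x" "(\<lambda>n. of_rat (Y n)) \<longlonglongrightarrow> y"
  from tendsto_add[OF this] show "\<exists>Z. (\<lambda>n. of_rat (Z n)) \<longlonglongrightarrow> x + y"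
    by (intro exI[of _ "\<lambda>n. X n + Y n"]) (simp add: of_rat_add)
qed

lemma padic_numbers_mult: "x \<in> padic_numbers \<Longrightarrow> y \<in> padic_numbers \<Longrightarrow> x * y \<in> padic_numbers"
  unfolding padic_numbers_sequence
proof safe
  fix X Y assume "(\<lambda>n. of_rat (X n)) \<longlonglongrightarrow> x" "(\<lambda>n. of_rat (Y n)) \<longlonglongrightarrow> y"
  from tendsto_mult[OF this] show "\<exists>Z. (\<lambda>n. of_rat (Z n)) \<longlonglongrightarrow> x * y"
    by (intro exI[of _ "\<lambda>n. X n * Y n"]) (simp add: of_rat_mult)
qed

lemma padic_numbers_diff:
  assumes "x \<in> padic_numbers" "y \<in> padic_numbers"
  shows "x - y \<in> padic_numbers"
  using padic_numbers_add[OF assms(1) padic_numbers_mult[OF padic_numbers_of_int[of "-1"] assms(2)]]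
  by simp

lemma padic_numbers_inverse: "x \<in> padic_numbers \<Longrightarrow> inverse x \<in> padic_numbers"
proof (cases "x = 0")
  case False
  assume "x \<in> padic_numbers"
  then obtain X where "(\<lambda>n. of_rat (X n)) \<longlonglongrightarrow> x"
    by (rule padic_numbers_sequence[THEN iffD1, THEN exE])
  from tendsto_inverse_valued[OF this False] show ?thesis
    unfolding padic_numbers_sequence
    by (intro exI[of _ "\<lambda>n. inverse (X n)"]) (simp add: of_rat_inverse)
qed simp

lemma padic_numbers_divide: "x \<in> padic_numbers \<Longrightarrow> y \<in> padic_numbers \<Longrightarrow> x / y \<in> padic_numbers"
  unfolding divide_inverse by (intro padic_numbers_mult padic_numbers_inverse)

lemma padic_integers_of_int [simp]: "of_int n \<in> padic_integers"
  by (simp add: padic_integers_def vabs_of_int_le_1)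

lemma padic_integers_of_nat [simp]: "of_nat n \<in> padic_integers"
  by (simp add: padic_integers_def vabs_of_nat_le_1)

lemma padic_integers_1 [simp]: "1 \<in> padic_integers"
  by (simp add: padic_integers_def)

lemma padic_integers_add: "x \<in> padic_integers \<Longrightarrow> y \<in> padic_integers \<Longrightarrow> x + y \<in> padic_integers"
  by (simp add: padic_integers_def padic_numbers_add vabs_add_le)

lemma padic_integers_mult: "x \<in> padic_integers \<Longrightarrow> y \<in> padic_integers \<Longrightarrow> x * y \<in> padic_integers"
  by (simp add: padic_integers_def padic_numbers_mult vabs_mult mult_le_one)

lemma padic_integers_power: "x \<in> padic_integers \<Longrightarrow> x ^ n \<in> padic_integers"
  by (induction n) (simp_all add: padic_integers_mult)

lemma padic_integers_vabs_le: "x \<in> padic_integers \<Longrightarrow> vabs x \<le> 1"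
  by (simp add: padic_integers_def)

lemma padic_integers_numbers: "x \<in> padic_integers \<Longrightarrow> x \<in> padic_numbers"
  by (simp add: padic_integers_def)

lemma padic_integers_limit:
  assumes "\<And>n. X n \<in> padic_integers" "X \<longlonglongrightarrow> l"
  shows "l \<in> padic_integers"
  unfolding padic_integers_def
proof safe
  have "closed padic_numbers"
    by (simp add: padic_numbers_def)
  then show "l \<in> padic_numbers"
    by (rule closed_sequentially[OF _ _ assms(2)]) (simp add: assms(1) padic_integers_numbers)
  show "vabs l \<le> 1"
    by (rule vabs_limit_le[OF assms(2)]) (simp add: assms(1) padic_integers_vabs_le)
qed

text \<open>The inverse lies in \<open>padic_numbers\<close> anyway; it is integral exactly when
  \<open>vabs y\<close> is at least \<open>1\<close>.\<close>

lemma padic_units_iff: "y \<in> padic_units \<longleftrightarrow> y \<in> padic_integers \<and> vabs y = 1"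
proof (cases "y = 0")
  case False
  have "vabs y = 1" if "vabs y \<le> 1" "inverse (vabs y) \<le> 1"
  proof -
    have "0 < vabs y"
      using False vabs_nonneg[of y] by (simp add: less_le)
    then have "1 \<le> vabs y"
      using that(2) by (simp add: field_simps)
    with that(1) show ?thesis
      by simp
  qed
  then show ?thesis
    using False by (auto simp: padic_units_def padic_integers_def padic_numbers_inverse vabs_inverse)
qed (simp add: padic_units_def)

section \<open>Integer approximation, congruences and extended characters\<close>

lemma periodic_eq:
  assumes period: "\<forall>a::int. chi (a + m) = chi a" and "m dvd a - b"
  shows "chi a = chi b"
proof -
  have nat: "chi (a + int n * m) = chi a" for a n
  proof (induction n)
    case (Suc n)
    then show ?case
      using period[rule_format, of "a + int n * m"] by (simp add: algebra_simps)
  qed simp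
  obtain k where k: "a = b + k * m"
    using assms(2) by (metis add_diff_cancel_left' diff_add_cancel dvdE mult.commute add.commute)
  show ?thesis
  proof (cases "k \<ge> 0")
    case True
    then show ?thesis
      using nat[of b "nat k"] k by simp
  next
    case False
    then show ?thesis
      using nat[of a "nat (- k)"] k by simp
  qed
qed

locale padic_field =
  fixes p :: nat and T :: "'a::{nonarch_valued_field, complete_space} itself"
  assumes prime: "prime p" and vabs_p: "vabs (of_nat p :: 'a) = 1 / real p"
begin

lemma p_gt_1: "1 < p"
  using prime by (rule prime_gt_1_nat)

lemma inverse_p_power_le: "v \<ge> 1 \<Longrightarrow> 1 / real p ^ v \<le> 1 / real p"
  using power_increasing[of 1 v "real p"] p_gt_1 by (simp add: field_simps)

lemma vabs_p_power: "vabs (of_nat p ^ k :: 'a) = 1 / real p ^ k"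
  by (simp add: vabs_power vabs_p power_one_over)

text \<open>In a Bezout relation \<open>a * n + b * p = 1\<close> the second summand has absolute
  value below \<open>1\<close>, so the first must reach \<open>1\<close>.\<close>

lemma vabs_of_int_coprime:
  assumes "coprime n (int p)"
  shows "vabs (of_int n :: 'a) = 1"
proof (rule antisym[OF vabs_of_int_le_1])
  obtain a b where "a * n + b * int p = 1"
    using bezout_int[of n "int p"] assms by (auto simp: coprime_iff_gcd_eq_1)
  then have "1 = of_int a * of_int n + of_int b * (of_nat p :: 'a)"
    by (metis of_int_1 of_int_add of_int_mult of_int_of_nat_eq)
  then have "1 \<le> max (vabs (of_int a :: 'a) * vabs (of_int n :: 'a)) (vabs (of_int b :: 'a) * (1 / real p))"
    using vabs_add_le_max[of "of_int a * of_int n" "of_int b * (of_nat p :: 'a)"]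
    by (simp add: vabs_mult vabs_p)
  moreover have "vabs (of_int b :: 'a) * (1 / real p) < 1"
    using p_gt_1 vabs_of_int_le_1[of b, where 'a = 'a] by (simp add: field_simps)
  moreover have "vabs (of_int a :: 'a) * vabs (of_int n :: 'a) \<le> vabs (of_int n :: 'a)"
    using vabs_of_int_le_1[of a, where 'a = 'a] by (simp add: mult_left_le_one_le)
  ultimately show "1 \<le> vabs (of_int n :: 'a)"
    by linarith
qed

lemma vabs_of_int_le_iff: "vabs (of_int n :: 'a) \<le> 1 / real p ^ k \<longleftrightarrow> int p ^ k dvd n"
proof
  assume "int p ^ k dvd n"
  then obtain m where "n = int p ^ k * m"
    by blast
  then show "vabs (of_int n :: 'a) \<le> 1 / real p ^ k"
    using vabs_of_int_le_1[of m, where 'a = 'a] by (simp add: vabs_mult vabs_p_power divide_right_mono)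
next
  show "vabs (of_int n :: 'a) \<le> 1 / real p ^ k \<Longrightarrow> int p ^ k dvd n"
  proof (induction k)
    case (Suc k)
    have "1 / real p ^ Suc k \<le> 1 / real p ^ k"
      using p_gt_1 by (simp add: field_simps)
    with Suc have "int p ^ k dvd n"
      by simp
    then obtain m where m: "n = int p ^ k * m"
      by blast
    then have "vabs (of_int m :: 'a) \<le> 1 / real p"
      using Suc.prems p_gt_1 by (simp add: vabs_mult vabs_p_power field_simps)
    \<comment> \<open>The cofactor left after removing \<open>p ^ k\<close> is smaller than
      \<open>1\<close>, hence not coprime to \<open>p\<close>, which supplies the next factor
      \<open>p\<close>.\<close>
    also have "\<dots> < 1"
      using p_gt_1 by simp
    finally have "\<not> coprime m (int p)"
      using vabs_of_int_coprime by force
    then have "int p dvd m"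
      using prime prime_imp_coprime[of "int p" m] by (auto simp: coprime_commute)
    then show ?case
      using m by simp
  qed simp
qed

text \<open>Density of the integers in the p-adic integers: a nearby rational has a denominator
  prime to \<open>p\<close>, and that denominator can be inverted modulo
  \<open>p ^ k\<close>.\<close>

lemma padic_integers_approx:
  assumes y: "(y :: 'a) \<in> padic_integers"
  obtains n :: int where "vabs (y - of_int n) \<le> 1 / real p ^ k"
proof -
  have "0 < 1 / real p ^ k"
    using p_gt_1 by simp
  then obtain q where q: "vabs (of_rat q - y) < 1 / real p ^ k"
    using padic_integers_numbers[OF y] unfolding padic_numbers_def closure_approachable dist_vabs
    by blast
  obtain a b where ab: "q = of_int a / of_int b" "b > 0" "coprime a b"
    by (metis Fract_of_int_quotient Rat_cases)
  then have q_eq: "(of_rat q :: 'a) = of_int a / of_int b"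
    by (simp add: of_rat_divide)
  have "1 / real p ^ k \<le> 1"
    using p_gt_1 by simp
  then have "vabs (of_rat q - y) \<le> 1"
    using q by linarith
  then have q1: "vabs (of_rat q :: 'a) \<le> 1"
    using vabs_add_le[of "of_rat q - y" 1 y] padic_integers_vabs_le[OF y] by simp
  \<comment> \<open>If \<open>p\<close> divided \<open>b\<close>, the numerator would be prime to
    \<open>p\<close> and the quotient would have absolute value above \<open>1\<close>.\<close>
  have b: "coprime b (int p)"
  proof (rule ccontr)
    assume "\<not> coprime b (int p)"
    then have pb: "int p dvd b"
      using prime prime_imp_coprime[of "int p" b] by (auto simp: coprime_commute)
    with ab(3) have "coprime a (int p)"
      using coprime_divisors[of a a "int p" b] by simp
    then have "vabs (of_rat q :: 'a) = 1 / vabs (of_int b :: 'a)"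
      by (simp add: q_eq vabs_divide vabs_of_int_coprime)
    moreover have "vabs (of_int b :: 'a) < 1"
    proof -
      have "vabs (of_int b :: 'a) \<le> 1 / real p"
        using vabs_of_int_le_iff[of b 1] pb by simp
      also have "\<dots> < 1"
        using p_gt_1 by simp
      finally show ?thesis .
    qed
    ultimately show False
      using q1 ab(2) mult_right_le_one_le[of "vabs (of_int b :: 'a)" "vabs (of_rat q :: 'a)"]
      by (simp add: field_simps)
  qed
  then have "coprime b (int p ^ k)"
    by simp
  \<comment> \<open>As \<open>c\<close> inverts \<open>b\<close> modulo \<open>p ^ k\<close>, the
    integer \<open>a * c\<close> agrees with \<open>a / b\<close> up to
    \<open>1 / p ^ k\<close>.\<close>
  then obtain c where c: "[b * c = 1] (mod int p ^ k)"
    using cong_solve_coprime_int by blast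
  then have "int p ^ k dvd a * (b * c - 1)"
    by (simp add: cong_iff_dvd_diff)
  then have "vabs (of_int (a * (b * c - 1)) :: 'a) \<le> 1 / real p ^ k"
    by (simp add: vabs_of_int_le_iff del: of_int_mult)
  moreover have "of_int (a * c) - of_rat q = of_int (a * (b * c - 1)) / (of_int b :: 'a)"
    using ab(2) by (simp add: q_eq field_simps)
  ultimately have qn: "vabs (of_rat q - of_int (a * c) :: 'a) \<le> 1 / real p ^ k"
    by (simp add: vabs_minus_commute[of "of_rat q"] vabs_divide vabs_of_int_coprime[OF b])
  have "vabs (y - of_rat q) \<le> 1 / real p ^ k"
    using q by (simp add: vabs_minus_commute[of y])
  from vabs_diff_trans[OF this qn] show thesis
    by (rule that)
qed

lemma padic_cong_power_iff:
  assumes "(y :: 'a) \<in> padic_numbers" "z \<in> padic_numbers"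
  shows "padic_cong (p ^ k) y z \<longleftrightarrow> vabs (y - z) \<le> 1 / real p ^ k"
proof
  assume "padic_cong (p ^ k) y z"
  then obtain w where w: "w \<in> padic_integers" "y - z = of_nat p ^ k * w"
    by (auto simp: padic_cong_def)
  then show "vabs (y - z) \<le> 1 / real p ^ k"
    using padic_integers_vabs_le[OF w(1)] by (simp add: vabs_mult vabs_p_power divide_right_mono)
next
  assume le: "vabs (y - z) \<le> 1 / real p ^ k"
  let ?w = "(y - z) / of_nat p ^ k"
  have p0: "(of_nat p ^ k :: 'a) \<noteq> 0"
    using p_gt_1 by simp
  have "vabs ?w \<le> 1"
    using le p_gt_1 by (simp add: vabs_divide vabs_p_power field_simps)
  moreover have "?w \<in> padic_numbers"
    using assms padic_numbers_of_nat[of "p ^ k"]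
    by (metis of_nat_power padic_numbers_diff padic_numbers_divide)
  ultimately have "?w \<in> padic_integers"
    by (simp add: padic_integers_def)
  moreover have "y - z = of_nat (p ^ k) * ?w"
    using p0 by simp
  ultimately show "padic_cong (p ^ k) y z"
    unfolding padic_cong_def by blast
qed

lemma padic_cong_iff:
  assumes "(y :: 'a) \<in> padic_numbers" "z \<in> padic_numbers"
  shows "padic_cong p y z \<longleftrightarrow> vabs (y - z) \<le> 1 / real p"
  using padic_cong_power_iff[OF assms, of 1] by simp

text \<open>Frees the extension from its \<open>SOME\<close>: two integers within
  \<open>1 / p ^ k\<close> of \<open>y\<close> differ by a multiple of \<open>p ^ k\<close>, so
  \<open>chi\<close> agrees on them.\<close>

lemma character_extension_eq:
  fixes y :: 'a and chi :: "int \<Rightarrow> 'a"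
  assumes period: "\<forall>a. chi (a + int (p ^ k)) = chi a"
    and y: "y \<in> padic_integers" and n: "vabs (y - of_int n) \<le> 1 / real p ^ k"
  shows "character_extension (p ^ k) chi y = chi n"
proof -
  have cong: "padic_cong (p ^ k) (of_int m) y \<longleftrightarrow> vabs (y - of_int m) \<le> 1 / real p ^ k" for m
    using y by (simp add: padic_cong_power_iff padic_integers_numbers vabs_minus_commute)
  define m where "m = (SOME m. padic_cong (p ^ k) (of_int m) y)"
  have "padic_cong (p ^ k) (of_int m) y"
    unfolding m_def using n cong by (metis (mono_tags, lifting) someI)
  then have "vabs (of_int m - y) \<le> 1 / real p ^ k"
    by (simp add: cong vabs_minus_commute)
  then have "vabs (of_int m - of_int n :: 'a) \<le> 1 / real p ^ k"
    using n by (rule vabs_diff_trans)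
  then have "int (p ^ k) dvd m - n"
    using vabs_of_int_le_iff[of "m - n" k] by simp
  with period show ?thesis
    unfolding character_extension_def m_def[symmetric] by (rule periodic_eq)
qed

section \<open>The Teichmueller representative\<close>

text \<open>Raising to the power \<open>p\<close> contracts each residue class, so a residue class contains at most
  one fixed point, and the iterates of any of its elements converge to it.\<close>

lemma vabs_power_p_diff_le:
  fixes z w :: 'a
  assumes z: "vabs z \<le> 1" and w: "vabs w \<le> 1" and zw: "vabs (z - w) \<le> 1 / real p"
  shows "vabs (z ^ p - w ^ p) \<le> vabs (z - w) / real p"
proof -
  \<comment> \<open>The cofactor of \<open>z - w\<close> in \<open>z ^ p - w ^ p\<close> has
    \<open>p\<close> summands, each congruent to \<open>w ^ (p - 1)\<close>; so it is congruent to
    \<open>p * w ^ (p - 1)\<close>, and this gains the factor \<open>1 / p\<close>.\<close>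
  have "vabs (w ^ (p - Suc i) * z ^ i - w ^ (p - 1)) \<le> 1 / real p" if "i < p" for i
  proof -
    have "w ^ (p - 1) = w ^ (p - Suc i) * w ^ i"
      using that by (simp flip: power_add)
    then have "w ^ (p - Suc i) * z ^ i - w ^ (p - 1) = w ^ (p - Suc i) * (z ^ i - w ^ i)"
      by (simp add: algebra_simps)
    moreover have "vabs (z ^ i - w ^ i) \<le> 1 / real p"
      using vabs_power_diff_le[OF z w, of i] zw by simp
    moreover have "vabs (w ^ (p - Suc i)) \<le> 1"
      using w by (simp add: vabs_power power_le_one)
    ultimately show ?thesis
      using mult_mono[of "vabs (w ^ (p - Suc i))" 1 "vabs (z ^ i - w ^ i)" "1 / real p"]
      by (simp add: vabs_mult)
  qed
  then have "vabs (\<Sum>i<p. w ^ (p - Suc i) * z ^ i - w ^ (p - 1)) \<le> 1 / real p"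
    by (intro vabs_sum_le) auto
  moreover have "vabs (of_nat p * w ^ (p - 1)) \<le> 1 / real p"
    using w by (simp add: vabs_mult vabs_p vabs_power power_le_one divide_right_mono)
  ultimately have "vabs ((\<Sum>i<p. w ^ (p - Suc i) * z ^ i - w ^ (p - 1)) + of_nat p * w ^ (p - 1)) \<le> 1 / real p"
    by (rule vabs_add_le)
  then have "vabs (\<Sum>i<p. w ^ (p - Suc i) * z ^ i) \<le> 1 / real p"
    by (simp add: sum_subtractf)
  then have "vabs (z - w) * vabs (\<Sum>i<p. w ^ (p - Suc i) * z ^ i) \<le> vabs (z - w) * (1 / real p)"
    by (intro mult_left_mono) auto
  then show ?thesis
    by (simp add: power_diff_sumr2 vabs_mult)
qed

text \<open>Both elements are fixed by the \<open>p\<close>-th power, while that map shrinks their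
  distance by a factor \<open>p\<close>.\<close>

lemma root_of_unity_unique:
  fixes z w :: 'a
  assumes "vabs z \<le> 1" "vabs w \<le> 1" "z ^ (p - 1) = 1" "w ^ (p - 1) = 1"
    and "vabs (z - w) \<le> 1 / real p"
  shows "z = w"
proof -
  have p: "p = Suc (p - 1)"
    using p_gt_1 by simp
  have "z ^ p = z" "w ^ p = w"
    using assms(3,4) by (subst p, simp)+
  then have "vabs (z - w) * real p \<le> vabs (z - w)"
    using vabs_power_p_diff_le[OF assms(1,2,5)] p_gt_1 by (simp add: field_simps)
  then have "vabs (z - w) = 0"
    using p_gt_1 vabs_nonneg[of "z - w"] by (smt (verit) mult_less_cancel_left1 of_nat_1 of_nat_less_iff)
  then show ?thesis
    by simp
qed

text \<open>Fermat's little theorem, carried over from a natural number in the residue class of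
  \<open>y\<close>.\<close>

lemma vabs_power_p_diff_self:
  fixes y :: 'a
  assumes y: "y \<in> padic_integers"
  shows "vabs (y ^ p - y) \<le> 1 / real p"
proof -
  obtain k where k: "vabs (y - of_int k) \<le> 1 / real p"
    using padic_integers_approx[OF y, of 1] by auto
  define n where "n = nat (k mod int p)"
  have n_mod: "int n = k mod int p"
    using p_gt_1 by (simp add: n_def)
  then have "vabs (of_int (k - int n) :: 'a) \<le> 1 / real p"
    using vabs_of_int_le_iff[of "k - int n" 1] by simp
  with k have n: "vabs (y - of_nat n) \<le> 1 / real p"
    using vabs_diff_trans[of y "of_int k" "1 / real p" "of_nat n"] by simp
  have "[n ^ p = n] (mod p)"
  proof (cases "p dvd n")
    case True
    then show ?thesis
      using p_gt_1 by (simp add: cong_def mod_eq_0_iff_dvd dvd_power_le dvd_trans[OF True] dvd_power)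
  next
    case False
    then have "[n * n ^ (p - 1) = n * 1] (mod p)"
      by (intro cong_scalar_left fermat_theorem prime)
    then show ?thesis
      using p_gt_1 by (simp flip: power_Suc)
  qed
  then have "int p dvd int n ^ p - int n"
    by (metis cong_iff_dvd_diff cong_int_iff of_nat_power)
  then have "vabs (of_nat n ^ p - of_nat n :: 'a) \<le> 1 / real p"
    using vabs_of_int_le_iff[of "int n ^ p - int n" 1] by simp
  moreover have "vabs (y ^ p - of_nat n ^ p) \<le> 1 / real p"
    using vabs_power_diff_le[OF padic_integers_vabs_le[OF y] vabs_of_nat_le_1[of n], of p] n by simp
  ultimately have "vabs (y ^ p - of_nat n) \<le> 1 / real p"
    using vabs_diff_trans by blast
  then show ?thesis
    using n vabs_minus_commute[of y] vabs_diff_trans[of "y ^ p" "of_nat n" _ y] by simp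
qed

text \<open>The representative is the limit of \<open>y ^ (p ^ n)\<close>: Fermat bounds the first
  step, and each later step is smaller by a factor \<open>p\<close>.\<close>

lemma teichmueller_exists:
  fixes y :: 'a
  assumes y: "y \<in> padic_integers" "vabs y = 1"
  shows "\<exists>z \<in> padic_integers. z ^ (p - 1) = 1 \<and> vabs (z - y) \<le> 1 / real p"
proof -
  define X where "X n = y ^ (p ^ n)" for n
  have X_Suc: "X (Suc n) = X n ^ p" for n
    by (simp add: X_def mult.commute flip: power_mult)
  have X_int: "X n \<in> padic_integers" for n
    by (simp add: X_def y padic_integers_power)
  have step: "vabs (X (Suc n) - X n) \<le> (1 / real p) ^ Suc n" for n
  proof (induction n)
    case 0
    then show ?case
      using vabs_power_p_diff_self[OF y(1)] by (simp add: X_def)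
  next
    case (Suc n)
    have "(1 / real p) ^ Suc n \<le> 1 / real p"
      using p_gt_1 power_decreasing[of 1 "Suc n" "1 / real p"] by simp
    then have "vabs (X (Suc n) - X n) \<le> 1 / real p"
      using Suc by linarith
    then have "vabs (X (Suc n) ^ p - X n ^ p) \<le> vabs (X (Suc n) - X n) / real p"
      by (intro vabs_power_p_diff_le padic_integers_vabs_le X_int)
    also have "\<dots> \<le> (1 / real p) ^ Suc n / real p"
      using Suc by (intro divide_right_mono) auto
    finally show ?case
      by (simp add: X_Suc)
  qed
  have "(\<lambda>n. (1 / real p) ^ Suc n) \<longlonglongrightarrow> 0"
    using p_gt_1 by (intro LIMSEQ_Suc LIMSEQ_power_zero) simp
  then have "(\<lambda>n. vabs (X (Suc n) - X n)) \<longlonglongrightarrow> 0"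
    by (rule tendsto_sandwich[OF _ _ tendsto_const, rotated 2]) (simp_all add: always_eventually step del: power_Suc)
  then obtain z where z: "X \<longlonglongrightarrow> z"
    using convergentD[OF convergent_ultrametric] by auto
  have "(\<lambda>n. X n ^ p) \<longlonglongrightarrow> z ^ p"
    by (rule tendsto_power_strong[OF z tendsto_const])
  moreover have "(\<lambda>n. X n ^ p) \<longlonglongrightarrow> z"
    using LIMSEQ_Suc[OF z] by (simp add: X_Suc)
  ultimately have zp: "z ^ p = z"
    by (rule LIMSEQ_unique)
  have "vabs (X n - y) \<le> 1 / real p" for n
  proof (induction n)
    case (Suc n)
    have "(1 / real p) ^ Suc n \<le> 1 / real p"
      using p_gt_1 power_decreasing[of 1 "Suc n" "1 / real p"] by simp
    with step[of n] have "vabs (X (Suc n) - X n) \<le> 1 / real p"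
      by linarith
    then show ?case
      using Suc by (rule vabs_diff_trans)
  qed (simp add: X_def)
  then have zy: "vabs (z - y) \<le> 1 / real p"
    by (rule vabs_limit_le[OF tendsto_diff[OF z tendsto_const]])
  have "1 / real p < 1"
    using p_gt_1 by simp
  then have "vabs z = 1"
    using vabs_eq_of_diff_less[of z y] zy y(2) by simp
  \<comment> \<open>Being close to a unit, the fixed point is nonzero, so \<open>z ^ p = z\<close>
    can be divided by \<open>z\<close>.\<close>
  then have "z \<noteq> 0"
    by auto
  moreover have "z * z ^ (p - 1) = z"
    using zp p_gt_1 by (cases p) simp_all
  ultimately have "z ^ (p - 1) = 1"
    by simp
  then show ?thesis
    using zy padic_integers_limit[OF X_int z] by blast
qed

text \<open>Existence and uniqueness justify the \<open>THE\<close> in the definition, so its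
  defining properties can be read off.\<close>

lemma teichmueller_unit:
  fixes y :: 'a
  assumes y: "y \<in> padic_integers" "vabs y = 1"
  shows "teichmueller p y \<in> padic_integers" "teichmueller p y ^ (p - 1) = 1"
    "vabs (teichmueller p y - y) \<le> 1 / real p"
proof -
  let ?P = "\<lambda>z. z \<in> padic_integers \<and> z ^ (p - 1) = 1 \<and> padic_cong p z y"
  have P: "?P z \<longleftrightarrow> z \<in> padic_integers \<and> z ^ (p - 1) = 1 \<and> vabs (z - y) \<le> 1 / real p" for z
    using y padic_cong_iff padic_integers_numbers by blast
  have "\<exists>!z. ?P z"
  proof (rule ex_ex1I)
    show "\<exists>z. ?P z"
      using teichmueller_exists[OF y] P by blast
    show "z = w" if "?P z" "?P w" for z w
    proof (rule root_of_unity_unique)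
      show "vabs (z - w) \<le> 1 / real p"
        using that[unfolded P] vabs_minus_commute[of y w] by (intro vabs_diff_trans[of z y _ w]) simp_all
    qed (use that padic_integers_vabs_le in blast)+
  qed
  then have "?P (THE z. ?P z)"
    by (rule theI')
  moreover have "teichmueller p y = (THE z. ?P z)"
    using y by (simp add: teichmueller_def padic_units_iff)
  ultimately have "?P (teichmueller p y)"
    by (simp only:)
  then show "teichmueller p y \<in> padic_integers" "teichmueller p y ^ (p - 1) = 1"
    "vabs (teichmueller p y - y) \<le> 1 / real p"
    unfolding P by blast+
qed

lemma vabs_eq_1_cong:
  fixes y z :: 'a
  assumes "vabs (y - z) \<le> 1 / real p"
  shows "vabs y = 1 \<longleftrightarrow> vabs z = 1"
proof -
  have "vabs (y - z) < 1" "vabs (z - y) < 1"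
    using assms p_gt_1 vabs_minus_commute[of y z] by (auto intro: le_less_trans)
  then show ?thesis
    using vabs_eq_of_diff_less[of y z] vabs_eq_of_diff_less[of z y] by auto
qed

lemma vabs_teichmueller:
  fixes y :: 'a
  assumes "y \<in> padic_integers" "vabs y = 1"
  shows "vabs (teichmueller p y) = 1"
  using vabs_eq_1_cong[OF teichmueller_unit(3)[OF assms]] assms(2) by simp

text \<open>For units, both representatives are roots of unity in one residue class, hence equal;
  otherwise both values are the default \<open>0\<close>.\<close>

lemma teichmueller_cong:
  fixes y z :: 'a
  assumes y: "y \<in> padic_integers" and z: "z \<in> padic_integers" and yz: "vabs (y - z) \<le> 1 / real p"
  shows "teichmueller p y = teichmueller p z"
proof (cases "vabs y = 1")
  case True
  then have "vabs z = 1"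
    using vabs_eq_1_cong[OF yz] by simp
  note ty = teichmueller_unit[OF y True] and tz = teichmueller_unit[OF z this]
  have "vabs (teichmueller p y - teichmueller p z) \<le> 1 / real p"
    using vabs_diff_trans[OF vabs_diff_trans[OF ty(3) yz], of "teichmueller p z"] tz(3)
    by (simp add: vabs_minus_commute)
  then show ?thesis
    using ty tz by (simp add: root_of_unity_unique padic_integers_vabs_le)
next
  case False
  then show ?thesis
    using vabs_eq_1_cong[OF yz] by (simp add: teichmueller_def padic_units_iff)
qed

end

section \<open>The binomial series\<close>

text \<open>The series of \<open>(1 + u)\<close> to the power \<open>t\<close>;
  \<open>padic_angle_power\<close> is its value at \<open>u = padic_angle p y - 1\<close>.\<close>

definition binomial_series :: "'a::nonarch_valued_field \<Rightarrow> 'a \<Rightarrow> 'a" where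
  "binomial_series t u = (\<Sum>k. (t gchoose k) * u ^ k)"

section \<open>Sizes of factorials and binomial coefficients, and convergence of the series\<close>

context padic_field
begin

text \<open>The radius of convergence of the p-adic exponential, that is, the geometric rate that
  bounds \<open>vabs (fact k)\<close> from below.\<close>

definition fact_radius :: real where
  "fact_radius = real p powr (- 1 / (real p - 1))"

lemma fact_radius_pos: "0 < fact_radius"
  using p_gt_1 by (simp add: fact_radius_def)

lemma fact_radius_le_1: "fact_radius \<le> 1"
proof -
  have "real p powr (- 1 / (real p - 1)) \<le> real p powr 0"
    using p_gt_1 by (intro powr_mono) simp_all
  then show ?thesis
    using p_gt_1 by (simp add: fact_radius_def)
qed

lemma fact_radius_power: "fact_radius ^ (p - 1) = 1 / real p"
proof -
  have "fact_radius ^ (p - 1) = real p powr (- 1 / (real p - 1) * real (p - 1))"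
    using p_gt_1 by (simp add: fact_radius_def powr_powr flip: powr_realpow)
  also have "- 1 / (real p - 1) * real (p - 1) = - 1"
    using p_gt_1 by (simp add: of_nat_diff)
  finally show ?thesis
    using p_gt_1 by (simp add: powr_minus_divide)
qed

text \<open>Explains the radius: the coefficients grow at most like powers of
  \<open>max 1 (vabs t) / fact_radius\<close>, and \<open>vabs u \<le> 1 / p\<close> gains a factor
  \<open>p\<close> per degree.\<close>

lemma zeta_radius_eq: "zeta_radius p = real p * fact_radius"
proof -
  have "real p powr ((real p - 2) / (real p - 1)) = real p powr (1 + (- 1 / (real p - 1)))"
    using p_gt_1 by (simp add: field_simps)
  also have "\<dots> = real p powr 1 * fact_radius"
    by (simp only: powr_add fact_radius_def)
  finally show ?thesis
    using p_gt_1 by (simp add: zeta_radius_def)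
qed

lemma vabs_of_nat_not_dvd: "\<not> p dvd n \<Longrightarrow> vabs (of_nat n :: 'a) = 1"
  using vabs_of_int_coprime[of "int n"] prime prime_imp_coprime[of p n]
  by (simp add: coprime_commute)

lemma vabs_fact_add:
  "r < p \<Longrightarrow> vabs (fact (p * m + r) :: 'a) = vabs (fact (p * m) :: 'a)"
proof (induction r)
  case (Suc r)
  have "\<not> p dvd Suc r"
    using Suc.prems by (intro nat_dvd_not_less) simp_all
  then have "\<not> p dvd p * m + Suc r"
    by (subst dvd_add_right_iff) simp_all
  then have "vabs (of_nat (p * m + Suc r) :: 'a) = 1"
    by (rule vabs_of_nat_not_dvd)
  moreover have "(fact (p * m + Suc r) :: 'a) = of_nat (p * m + Suc r) * fact (p * m + r)"
    by (simp only: add_Suc_right fact_Suc)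
  ultimately have "vabs (fact (p * m + Suc r) :: 'a) = vabs (fact (p * m + r) :: 'a)"
    by (simp only: vabs_mult mult_1)
  then show ?case
    using Suc.IH Suc.prems by simp
qed simp

text \<open>Each block of \<open>p\<close> consecutive factors contains a single multiple of
  \<open>p\<close>, namely \<open>p * Suc m\<close>; the other factors have absolute value
  \<open>1\<close>.\<close>

lemma vabs_fact_mult: "vabs (fact (p * m) :: 'a) = vabs (fact m :: 'a) / real p ^ m"
proof (induction m)
  case (Suc m)
  have "p * Suc m = Suc (p * m + (p - 1))"
    using p_gt_1 by simp
  then have "(fact (p * Suc m) :: 'a) = of_nat (p * Suc m) * fact (p * m + (p - 1))"
    by (metis fact_Suc)
  then have "vabs (fact (p * Suc m) :: 'a)
      = 1 / real p * vabs (of_nat (Suc m) :: 'a) * vabs (fact (p * m + (p - 1)) :: 'a)"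
    by (simp only: vabs_mult of_nat_mult vabs_p)
  moreover have "vabs (fact (p * m + (p - 1)) :: 'a) = vabs (fact m :: 'a) / real p ^ m"
    using vabs_fact_add[of "p - 1" m] p_gt_1 Suc by simp
  ultimately show ?case
    by (simp add: vabs_mult del: of_nat_Suc mult_Suc_right)
qed simp

text \<open>A bound in place of Legendre's exact formula, by recursion from \<open>k\<close> to
  \<open>k div p\<close>. The remainder \<open>k mod p\<close> only makes the left side smaller, as
  \<open>fact_radius \<le> 1\<close>.\<close>

lemma vabs_fact_ge: "fact_radius ^ k \<le> vabs (fact k :: 'a)"
proof (induction k rule: less_induct)
  case (less k)
  show ?case
  proof (cases "k = 0")
    case False
    define m where "m = k div p"
    have k: "p * m + k mod p = k"
      by (simp add: m_def)
    have "m < k"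
      using False p_gt_1 by (simp add: m_def)
    have "fact_radius ^ k \<le> fact_radius ^ (p * m)"
      using k fact_radius_pos fact_radius_le_1 by (intro power_decreasing) auto
    \<comment> \<open>The split isolates \<open>fact_radius ^ (p - 1) = 1 / p\<close>, which matches
      the factor \<open>1 / p ^ m\<close> in \<open>vabs_fact_mult\<close>.\<close>
    also have "p * m = m + (p - 1) * m"
      using p_gt_1 by (cases p) simp_all
    also have "fact_radius ^ (m + (p - 1) * m) = fact_radius ^ m / real p ^ m"
      by (simp only: power_add power_mult fact_radius_power power_one_over) simp
    also have "\<dots> \<le> vabs (fact m :: 'a) / real p ^ m"
      using less[OF \<open>m < k\<close>] by (simp add: divide_right_mono)
    also have "\<dots> = vabs (fact (p * m + k mod p) :: 'a)"
      using p_gt_1 by (simp only: vabs_fact_mult vabs_fact_add mod_less_divisor)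
    also have "\<dots> = vabs (fact k :: 'a)"
      by (simp only: k)
    finally show ?thesis .
  qed simp
qed

lemma vabs_gbinomial_le:
  fixes t :: 'a
  shows "vabs (t gchoose k) \<le> (max 1 (vabs t) / fact_radius) ^ k"
proof -
  have "vabs (\<Prod>i = 0..<k. t - of_nat i) \<le> (\<Prod>i = 0..<k. max 1 (vabs t))"
    unfolding vabs_prod
    by (intro prod_mono conjI vabs_nonneg vabs_diff_le) (simp_all add: le_max_iff_disj vabs_of_nat_le_1)
  then have "vabs (t gchoose k) \<le> max 1 (vabs t) ^ k / vabs (fact k :: 'a)"
    by (simp add: gbinomial_prod_rev vabs_divide divide_right_mono)
  also have "\<dots> \<le> max 1 (vabs t) ^ k / fact_radius ^ k"
    using less_le_trans[OF _ vabs_fact_ge[of k]] fact_radius_pos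
    by (intro divide_left_mono mult_pos_pos vabs_fact_ge) simp_all
  finally show ?thesis
    by (simp add: power_divide)
qed

text \<open>The ratio is \<open>max 1 (vabs t) / zeta_radius p\<close>;
  \<open>1 < zeta_radius p\<close> keeps it below \<open>1\<close> even for small
  \<open>t\<close>.\<close>

lemma vabs_gbinomial_le_geometric:
  fixes t :: 'a
  assumes "vabs t < zeta_radius p" "1 < zeta_radius p"
  obtains r where "0 \<le> r" "r < 1" "\<And>k. vabs (t gchoose k) \<le> r ^ k * real p ^ k"
proof
  let ?r = "max 1 (vabs t) / zeta_radius p"
  show "0 \<le> ?r" "?r < 1"
    using assms by (simp_all add: le_max_iff_disj)
  show "vabs (t gchoose k) \<le> ?r ^ k * real p ^ k" for k
    using vabs_gbinomial_le[of t k] p_gt_1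
    by (simp add: zeta_radius_eq flip: power_mult_distrib)
qed

lemma binomial_series_sums:
  fixes t u :: 'a
  assumes "vabs t < zeta_radius p" "1 < zeta_radius p" and u: "vabs u \<le> 1 / real p"
  shows "(\<lambda>k. (t gchoose k) * u ^ k) sums binomial_series t u"
  unfolding binomial_series_def
proof (rule summable_sums, rule summable_ultrametric)
  obtain r where r: "0 \<le> r" "r < 1" "\<And>k. vabs (t gchoose k) \<le> r ^ k * real p ^ k"
    using vabs_gbinomial_le_geometric[OF assms(1,2)] by blast
  have bound: "vabs ((t gchoose k) * u ^ k) \<le> r ^ k" for k
  proof -
    have "vabs ((t gchoose k) * u ^ k) \<le> (r ^ k * real p ^ k) * (1 / real p) ^ k"
      unfolding vabs_mult vabs_power using r u by (intro mult_mono power_mono) simp_all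
    also have "\<dots> = r ^ k"
      using p_gt_1 by (simp add: power_one_over)
    finally show ?thesis .
  qed
  have "(\<lambda>k. r ^ k) \<longlonglongrightarrow> 0"
    using r by (intro LIMSEQ_power_zero) simp
  then show "(\<lambda>k. vabs ((t gchoose k) * u ^ k)) \<longlonglongrightarrow> 0"
    by (rule tendsto_sandwich[OF _ _ tendsto_const, rotated 2]) (simp_all add: bound)
qed

lemma vabs_binomial_series_diff_le:
  fixes t u w :: 'a
  assumes t: "vabs t < zeta_radius p" "1 < zeta_radius p"
    and u: "vabs u \<le> 1 / real p" and w: "vabs w \<le> 1 / real p"
  shows "vabs (binomial_series t u - binomial_series t w) \<le> real p * vabs (u - w)"
proof -
  obtain r where r: "0 \<le> r" "r < 1" "\<And>k. vabs (t gchoose k) \<le> r ^ k * real p ^ k"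
    using vabs_gbinomial_le_geometric[OF t] by blast
  have summand: "vabs ((t gchoose k) * u ^ k - (t gchoose k) * w ^ k) \<le> real p * vabs (u - w)" for k
  proof (cases k)
    case (Suc j)
    have "r ^ k \<le> 1"
      using r by (intro power_le_one) auto
    have "vabs ((t gchoose k) * u ^ k - (t gchoose k) * w ^ k) = vabs (t gchoose k) * vabs (u ^ k - w ^ k)"
      by (simp flip: vabs_mult right_diff_distrib)
    \<comment> \<open>The power difference has only \<open>k - 1\<close> factors
      \<open>1 / p\<close> against \<open>p ^ k\<close> from the coefficient; the surplus
      \<open>p\<close> is the Lipschitz constant.\<close>
    also have "\<dots> \<le> (r ^ k * real p ^ k) * (vabs (u - w) * (1 / real p) ^ (k - 1))"
      using r vabs_power_diff_le[OF u w] by (intro mult_mono) simp_all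
    also have "\<dots> = r ^ k * (real p * vabs (u - w))"
      using p_gt_1 by (simp add: Suc power_one_over)
    also have "\<dots> \<le> real p * vabs (u - w)"
      using \<open>r ^ k \<le> 1\<close> r(1) by (intro mult_left_le_one_le) simp_all
    finally show ?thesis .
  qed simp
  have "(\<lambda>n. \<Sum>k<n. (t gchoose k) * u ^ k - (t gchoose k) * w ^ k)
      \<longlonglongrightarrow> binomial_series t u - binomial_series t w"
    using tendsto_diff[OF binomial_series_sums[OF t u, unfolded sums_def]
        binomial_series_sums[OF t w, unfolded sums_def]]
    by (simp add: sum_subtractf)
  then show ?thesis
    by (rule vabs_limit_le) (simp add: vabs_sum_le summand)
qed

text \<open>Pascal's rule turns a partial sum at \<open>t + 1\<close> into two partial sums at
  \<open>t\<close>, of lengths \<open>Suc n\<close> and \<open>n\<close>, with a common limit.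
  Convergence at \<open>t + 1\<close> comes out along the way.\<close>

lemma binomial_series_add_1:
  fixes t u :: 'a
  assumes "vabs t < zeta_radius p" "1 < zeta_radius p" "vabs u \<le> 1 / real p"
  shows "binomial_series (t + 1) u = (1 + u) * binomial_series t u"
proof -
  let ?S = "\<lambda>n. \<Sum>k<n. (t gchoose k) * u ^ k"
  have S: "?S \<longlonglongrightarrow> binomial_series t u"
    using binomial_series_sums[OF assms] by (simp add: sums_def)
  have "(\<Sum>k<Suc n. ((t + 1) gchoose k) * u ^ k) = ?S (Suc n) + u * ?S n" for n
  proof -
    have "((t + 1) gchoose Suc k) * u ^ Suc k = (t gchoose Suc k) * u ^ Suc k + u * ((t gchoose k) * u ^ k)" for k
      by (simp add: gbinomial_Suc_Suc distrib_right)
    then show ?thesis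
      unfolding sum.lessThan_Suc_shift by (simp add: sum.distrib sum_distrib_left)
  qed
  moreover have "(\<lambda>n. ?S (Suc n) + u * ?S n) \<longlonglongrightarrow> binomial_series t u + u * binomial_series t u"
    by (intro tendsto_add tendsto_mult tendsto_const LIMSEQ_Suc S)
  ultimately have "(\<lambda>n. \<Sum>k<Suc n. ((t + 1) gchoose k) * u ^ k) \<longlonglongrightarrow> (1 + u) * binomial_series t u"
    by (simp add: algebra_simps)
  then have "(\<lambda>k. ((t + 1) gchoose k) * u ^ k) sums ((1 + u) * binomial_series t u)"
    unfolding sums_def by (rule LIMSEQ_imp_Suc)
  then show ?thesis
    unfolding binomial_series_def by (rule sums_unique[symmetric])
qed

section \<open>The integrand of the zeta function\<close>

lemma vabs_padic_angle_diff_1: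
  fixes y :: 'a
  assumes y: "y \<in> padic_integers" "vabs y = 1"
  shows "vabs (padic_angle p y - 1) \<le> 1 / real p"
proof -
  have "teichmueller p y \<noteq> 0"
    using vabs_teichmueller[OF y] by auto
  then have "padic_angle p y - 1 = (y - teichmueller p y) / teichmueller p y"
    by (simp add: padic_angle_def diff_divide_distrib)
  then show ?thesis
    using teichmueller_unit(3)[OF y] by (simp add: vabs_divide vabs_teichmueller[OF y] vabs_minus_commute)
qed

lemma padic_angle_power_eq: "padic_angle_power p y t = binomial_series t (padic_angle p y - 1)"
  by (simp add: padic_angle_power_def binomial_series_def)

text \<open>Congruent units share their Teichmueller representative, so passing to
  \<open>padic_angle\<close> preserves distances and the Lipschitz bound of the series
  applies.\<close>

lemma vabs_padic_angle_power_diff_le: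
  fixes y z t :: 'a
  assumes t: "vabs t < zeta_radius p" "1 < zeta_radius p"
    and y: "y \<in> padic_integers" "vabs y = 1" and z: "z \<in> padic_integers" "vabs z = 1"
    and yz: "vabs (y - z) \<le> 1 / real p"
  shows "vabs (padic_angle_power p y t - padic_angle_power p z t) \<le> real p * vabs (y - z)"
proof -
  have "padic_angle p y - 1 - (padic_angle p z - 1) = (y - z) / teichmueller p y"
    using teichmueller_cong[OF y(1) z(1) yz] by (simp add: padic_angle_def diff_divide_distrib)
  then have "vabs (padic_angle p y - 1 - (padic_angle p z - 1)) = vabs (y - z)"
    by (simp add: vabs_divide vabs_teichmueller[OF y])
  then show ?thesis
    using vabs_binomial_series_diff_le[OF t vabs_padic_angle_diff_1[OF y] vabs_padic_angle_diff_1[OF z]]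
    by (simp add: padic_angle_power_eq)
qed

text \<open>The source of the twist: a factor \<open>y\<close> is traded for a factor
  \<open>teichmueller p y\<close> and an exponent larger by one.\<close>

lemma padic_angle_power_add_1:
  fixes y t :: 'a
  assumes t: "vabs t < zeta_radius p" "1 < zeta_radius p"
    and y: "y \<in> padic_integers" "vabs y = 1"
  shows "teichmueller p y * padic_angle_power p y (t + 1) = y * padic_angle_power p y t"
proof -
  have "teichmueller p y \<noteq> 0"
    using vabs_teichmueller[OF y] by auto
  then have "teichmueller p y * padic_angle p y = y"
    by (simp add: padic_angle_def)
  then show ?thesis
    using binomial_series_add_1[OF t vabs_padic_angle_diff_1[OF y]]
    by (simp add: padic_angle_power_eq flip: mult.assoc)
qed

text \<open>Periodicity and vanishing off the integers prime to \<open>p\<close> are properties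
  shared by \<open>chi\<close> and its product with the Teichmueller character, so both integrands
  are covered.\<close>

lemma uniformly_continuous_zeta_integrand:
  fixes chi :: "int \<Rightarrow> 'a" and t :: 'a
  assumes t: "vabs t < zeta_radius p" "1 < zeta_radius p" and v: "v \<ge> 1"
    and period: "\<forall>a. chi (a + int (p ^ v)) = chi a"
    and zero: "\<And>a. \<not> coprime a (int p) \<Longrightarrow> chi a = 0"
  shows "uniformly_continuous_on padic_integers
    (\<lambda>y. character_extension (p ^ v) chi y * padic_angle_power p y t)"
  unfolding uniformly_continuous_on_def
proof (intro allI impI)
  let ?f = "\<lambda>y. character_extension (p ^ v) chi y * padic_angle_power p y t"
  note v1 = inverse_p_power_le[OF v]
  \<comment> \<open>A period gives finitely many values, so \<open>chi\<close> is bounded; inserting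
    \<open>1\<close> makes \<open>B\<close> positive, as the division by \<open>B\<close> below
    requires.\<close>
  define B where "B = Max (insert 1 ((\<lambda>a. vabs (chi a)) ` {0..<int (p ^ v)}))"
  have "0 < B"
    unfolding B_def by (subst Max_gr_iff) auto
  have B: "vabs (chi a) \<le> B" for a
  proof -
    have "chi a = chi (a mod int (p ^ v))"
      using period by (rule periodic_eq) simp
    moreover have "a mod int (p ^ v) \<in> {0..<int (p ^ v)}"
      using p_gt_1 by simp
    ultimately show ?thesis
      unfolding B_def by (intro Max_ge) auto
  qed
  fix e :: real assume "0 < e"
  \<comment> \<open>The first bound keeps both points in one class modulo \<open>p ^ v\<close>,
    where the character is constant; the second absorbs \<open>B\<close> and the Lipschitz constant
    \<open>p\<close>.\<close>
  define d where "d = min (1 / real p ^ v) (e / (B * real p))"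
  have "0 < d"
    using \<open>0 < e\<close> \<open>0 < B\<close> p_gt_1 by (simp add: d_def)
  moreover have "dist (?f z) (?f y) < e"
    if y: "y \<in> padic_integers" and z: "z \<in> padic_integers" and "dist z y < d" for y z
  proof -
    have zy: "vabs (z - y) < 1 / real p ^ v" "vabs (z - y) < e / (B * real p)"
      using that(3) by (simp_all add: d_def dist_vabs)
    obtain n where n: "vabs (y - of_int n) \<le> 1 / real p ^ v"
      using padic_integers_approx[OF y] .
    then have n': "vabs (z - of_int n) \<le> 1 / real p ^ v"
      using zy(1) vabs_diff_trans[of z y _ "of_int n"] by simp
    note ext = character_extension_eq[OF period y n] character_extension_eq[OF period z n']
    show ?thesis
    proof (cases "coprime n (int p)")
      case True
      then have y1: "vabs y = 1" and z1: "vabs z = 1"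
        using vabs_eq_1_cong[of y "of_int n"] vabs_eq_1_cong[of z "of_int n"] n n' v1
        by (simp_all add: vabs_of_int_coprime)
      have "vabs (z - y) \<le> 1 / real p"
        using zy(1) v1 by linarith
      then have le: "vabs (padic_angle_power p z t - padic_angle_power p y t) \<le> real p * vabs (z - y)"
        by (rule vabs_padic_angle_power_diff_le[OF t z z1 y y1])
      have "dist (?f z) (?f y) = vabs (chi n) * vabs (padic_angle_power p z t - padic_angle_power p y t)"
        by (simp add: ext dist_vabs flip: vabs_mult right_diff_distrib)
      also have "\<dots> \<le> B * (real p * vabs (z - y))"
        using B le \<open>0 < B\<close> by (intro mult_mono) simp_all
      also have "\<dots> < e"
        using zy(2) \<open>0 < B\<close> p_gt_1 by (simp add: field_simps)
      finally show ?thesis .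
    next
      case False
      then show ?thesis
        using \<open>0 < e\<close> by (simp add: ext zero)
    qed
  qed
  ultimately show "\<exists>d>0. \<forall>y\<in>padic_integers. \<forall>z\<in>padic_integers. dist z y < d \<longrightarrow> dist (?f z) (?f y) < e"
    by blast
qed

lemma character_extension_mult_teichmueller:
  fixes y :: 'a and chi :: "int \<Rightarrow> 'a"
  assumes v: "v \<ge> 1" and y: "y \<in> padic_integers"
    and period: "\<forall>a. chi (a + int (p ^ v)) = chi a"
  shows "\<forall>a. chi (a + int (p ^ v)) * teichmueller_character p (a + int (p ^ v))
      = chi a * teichmueller_character p a"
    and "character_extension (p ^ v) (\<lambda>n. chi n * teichmueller_character p n) y
      = character_extension (p ^ v) chi y * teichmueller p y"
proof -
  note v1 = inverse_p_power_le[OF v]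
  have "teichmueller p (of_int (a + int (p ^ v)) :: 'a) = teichmueller p (of_int a)" for a
    using v1 by (intro teichmueller_cong padic_integers_of_int) (simp add: vabs_p_power)
  then show period': "\<forall>a. chi (a + int (p ^ v)) * teichmueller_character p (a + int (p ^ v))
      = chi a * teichmueller_character p a"
    using period by (simp add: teichmueller_character_def)
  obtain n where n: "vabs (y - of_int n) \<le> 1 / real p ^ v"
    using padic_integers_approx[OF y] .
  have "teichmueller p y = teichmueller p (of_int n :: 'a)"
    using n v1 by (intro teichmueller_cong y) simp_all
  then show "character_extension (p ^ v) (\<lambda>n. chi n * teichmueller_character p n) y
      = character_extension (p ^ v) chi y * teichmueller p y"
    using character_extension_eq[OF period' y n] character_extension_eq[OF period y n]
    by (simp add: teichmueller_character_def)
qed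

end

section \<open>The fermionic integral\<close>

lemma fermionic_sum_tendsto:
  "fermionic_integrable p f \<Longrightarrow> fermionic_sum p f \<longlonglongrightarrow> fermionic_integral p f"
  unfolding fermionic_integrable_def fermionic_integral_def by (simp add: convergent_LIMSEQ_iff)

lemma fermionic_integralI:
  assumes "fermionic_sum p f \<longlonglongrightarrow> l"
  shows "fermionic_integrable p f" "fermionic_integral p f = l"
  using assms by (auto simp: fermionic_integrable_def fermionic_integral_def convergent_def limI)

text \<open>Shifting the index flips the sign, so the two sums cancel up to their boundary
  terms.\<close>

lemma sum_alternating_Suc:
  fixes g :: "nat \<Rightarrow> 'a::comm_ring_1"
  shows "(\<Sum>a<n. (- 1) ^ a * g (Suc a)) + (\<Sum>a<n. (- 1) ^ a * g a) = g 0 - (- 1) ^ n * g n"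
  by (induction n) (simp_all add: algebra_simps)

lemma sum_alternating_odd: "odd n \<Longrightarrow> (\<Sum>k<n. (- 1) ^ k) = (1 :: 'a::comm_ring_1)"
proof -
  have "(\<Sum>k<n. (- 1) ^ k) = (if odd n then 1 else 0 :: 'a)" for n
    by (induction n) auto
  then show "odd n \<Longrightarrow> ?thesis"
    by simp
qed

text \<open>Since the block length \<open>n\<close> is odd, \<open>(- 1) ^ (k * n + a)\<close> is
  \<open>(- 1) ^ k * (- 1) ^ a\<close>.\<close>

lemma sum_alternating_blocks:
  fixes g :: "nat \<Rightarrow> 'a::comm_ring_1"
  assumes "odd n"
  shows "(\<Sum>a<m * n. (- 1) ^ a * g a) = (\<Sum>k<m. (- 1) ^ k * (\<Sum>a<n. (- 1) ^ a * g (k * n + a)))"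
proof (induction m)
  case (Suc m)
  have "(\<Sum>a<Suc m * n. (- 1) ^ a * g a)
      = (\<Sum>a<m * n. (- 1) ^ a * g a) + (\<Sum>a\<in>{m * n..<m * n + n}. (- 1) ^ a * g a)"
    by (simp add: lessThan_atLeast0 add.commute sum.atLeastLessThan_concat)
  also have "(\<Sum>a\<in>{m * n..<m * n + n}. (- 1) ^ a * g a) = (\<Sum>a<n. (- 1) ^ (m * n + a) * g (m * n + a))"
    using sum.shift_bounds_nat_ivl[of "\<lambda>a. (- 1) ^ a * g a" 0 "m * n" n]
    by (simp add: lessThan_atLeast0 add.commute)
  also have "\<dots> = (- 1) ^ m * (\<Sum>a<n. (- 1) ^ a * g (m * n + a))"
    using assms by (simp add: power_add power_mult minus_one_power_iff sum_distrib_left sum_negf)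
  finally show ?case
    using Suc by simp
qed simp

text \<open>The partial sums of the iterated integral collapse once the functional equation
  \<open>F (b + 1) + F b = 2 g b\<close> of the inner integral is unfolded.\<close>

lemma sum_alternating_iterated:
  fixes F g :: "nat \<Rightarrow> 'a::comm_ring_1"
  assumes "\<And>b. F (Suc b) + F b = 2 * g b"
  shows "(\<Sum>b<n. (- 1) ^ b * F b)
    = of_nat n * F 0 - 2 * (of_nat n - 1) * (\<Sum>j<n. (- 1) ^ j * g j) + 2 * (\<Sum>j<n. (- 1) ^ j * (of_nat j * g j))"
proof (induction n)
  case (Suc n)
  \<comment> \<open>The recursion telescopes once multiplied by its sign. Summed over
    \<open>b < n\<close>, the index \<open>j\<close> occurs \<open>n - 1 - j\<close> times, whence
    the coefficients \<open>n - 1\<close> and \<open>j\<close> in the claim.\<close>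
  have F: "(- 1) ^ b * F b = F 0 - 2 * (\<Sum>j<b. (- 1) ^ j * g j)" for b
  proof (induction b)
    case (Suc b)
    have "F (Suc b) = 2 * g b - F b"
      using assms[of b] by (metis add_diff_cancel_right')
    then have "(- 1) ^ Suc b * F (Suc b) = (- 1) ^ Suc b * (2 * g b - F b)"
      by (simp only:)
    also have "\<dots> = (- 1) ^ b * F b - 2 * ((- 1) ^ b * g b)"
      by (simp add: algebra_simps)
    also have "\<dots> = F 0 - 2 * (\<Sum>j<Suc b. (- 1) ^ j * g j)"
      unfolding Suc by (simp add: distrib_left)
    finally show ?case .
  qed simp
  show ?case
    unfolding sum.lessThan_Suc Suc.IH unfolding F by (simp add: algebra_simps)
qed simp

section \<open>Fermionic integrals of uniformly continuous functions\<close>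

context padic_field
begin

lemma tendsto_p_power: "(\<lambda>N. of_nat (p ^ N) :: 'a) \<longlonglongrightarrow> 0"
proof -
  have "(\<lambda>N. (1 / real p) ^ N) \<longlonglongrightarrow> 0"
    using p_gt_1 by (intro LIMSEQ_power_zero) simp
  then show ?thesis
    by (simp add: tendsto_vabs_diff_iff vabs_p_power power_one_over)
qed

lemma fermionic_integrable_uniformly_continuous:
  fixes f :: "'a \<Rightarrow> 'a"
  assumes "odd p" and f: "uniformly_continuous_on padic_integers f" and x: "x \<in> padic_integers"
  shows "fermionic_integrable p (\<lambda>a. f (x + a))"
  unfolding fermionic_integrable_def
proof (rule convergent_ultrametric, rule LIMSEQ_I)
  let ?S = "fermionic_sum p (\<lambda>a. f (x + a))"
  fix e :: real assume "0 < e"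
  then obtain d where "0 < d" and d: "\<And>y z. y \<in> padic_integers \<Longrightarrow> z \<in> padic_integers
      \<Longrightarrow> vabs (z - y) < d \<Longrightarrow> vabs (f z - f y) < e / 2"
    using f half_gt_zero[OF \<open>0 < e\<close>] unfolding uniformly_continuous_on_def dist_vabs by meson
  have "(\<lambda>N. vabs (of_nat (p ^ N) :: 'a)) \<longlonglongrightarrow> 0"
    using tendsto_vabs[OF tendsto_p_power] by simp
  then have "\<forall>\<^sub>F N in sequentially. vabs (of_nat (p ^ N) :: 'a) < d"
    using \<open>0 < d\<close> by (rule order_tendstoD)
  then obtain M where M: "\<And>N. N \<ge> M \<Longrightarrow> vabs (of_nat (p ^ N) :: 'a) < d"
    unfolding eventually_sequentially by blast
  have "vabs (?S (Suc N) - ?S N) < e" if "N \<ge> M" for N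
  proof -
    let ?n = "p ^ N"
    \<comment> \<open>For odd \<open>p\<close> the outer signs sum to \<open>1\<close>, so the sum
      at level \<open>N\<close> can be repeated over the \<open>p\<close> blocks of level
      \<open>Suc N\<close> and compared termwise, at arguments differing by
      \<open>k * p ^ N\<close>.\<close>
    have "?S N = (\<Sum>k<p. (- 1) ^ k * (\<Sum>a<?n. (- 1) ^ a * f (x + of_nat a)))"
      using sum_alternating_odd[OF \<open>odd p\<close>, where 'a = 'a]
      by (simp add: fermionic_sum_def flip: sum_distrib_right)
    moreover have "?S (Suc N) = (\<Sum>k<p. (- 1) ^ k * (\<Sum>a<?n. (- 1) ^ a * f (x + of_nat (k * ?n + a))))"
      using sum_alternating_blocks[of ?n "\<lambda>a. f (x + of_nat a)" p] \<open>odd p\<close>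
      by (simp add: fermionic_sum_def)
    ultimately have diff: "?S (Suc N) - ?S N = (\<Sum>k<p. (- 1) ^ k *
        (\<Sum>a<?n. (- 1) ^ a * (f (x + of_nat (k * ?n + a)) - f (x + of_nat a))))"
      by (simp only: sum_subtractf right_diff_distrib)
    have "vabs (f (x + of_nat (k * ?n + a)) - f (x + of_nat a)) \<le> e / 2" for k a
    proof -
      have "vabs (of_nat k * of_nat ?n :: 'a) \<le> 1 * vabs (of_nat ?n :: 'a)"
        unfolding vabs_mult by (intro mult_right_mono vabs_of_nat_le_1 vabs_nonneg)
      also have "\<dots> < d"
        using M[OF that] by simp
      finally have "vabs (x + of_nat (k * ?n + a) - (x + of_nat a)) < d"
        by simp
      then have "vabs (f (x + of_nat (k * ?n + a)) - f (x + of_nat a)) < e / 2"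
        by (intro d padic_integers_add x padic_integers_of_nat)
      then show ?thesis
        by simp
    qed
    then have "vabs (\<Sum>a<?n. (- 1) ^ a * (f (x + of_nat (k * ?n + a)) - f (x + of_nat a))) \<le> e / 2" for k
      using \<open>0 < e\<close> by (intro vabs_sum_le) (simp_all add: vabs_mult vabs_power del: of_nat_add)
    then have "vabs (?S (Suc N) - ?S N) \<le> e / 2"
      unfolding diff using \<open>0 < e\<close> by (intro vabs_sum_le) (simp_all add: vabs_mult vabs_power)
    then show ?thesis
      using \<open>0 < e\<close> by simp
  qed
  then show "\<exists>M. \<forall>N\<ge>M. norm (vabs (?S (Suc N) - ?S N) - 0) < e"
    by auto
qed

text \<open>The partial sums telescope to \<open>f y + f (y + p ^ N)\<close>, because
  \<open>p ^ N\<close> is odd, and continuity at \<open>y\<close> gives the limit.\<close>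

lemma fermionic_integral_shift:
  fixes f :: "'a \<Rightarrow> 'a"
  assumes "odd p" and f: "uniformly_continuous_on padic_integers f" and y: "y \<in> padic_integers"
  shows "fermionic_integral p (\<lambda>a. f (y + 1 + a)) + fermionic_integral p (\<lambda>a. f (y + a)) = 2 * f y"
proof -
  let ?S = "\<lambda>y. fermionic_sum p (\<lambda>a. f (y + a))"
  have "?S (y + 1) N + ?S y N = f y + f (y + of_nat (p ^ N))" for N
    using sum_alternating_Suc[of "\<lambda>a. f (y + of_nat a)" "p ^ N"] \<open>odd p\<close>
    by (simp add: fermionic_sum_def add.assoc)
  moreover have "(\<lambda>N. f (y + of_nat (p ^ N))) \<longlonglongrightarrow> f (y + 0)"
  proof (rule continuous_on_tendsto_compose[OF uniformly_continuous_imp_continuous[OF f]])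
    show "(\<lambda>N. y + of_nat (p ^ N)) \<longlonglongrightarrow> y + 0"
      by (intro tendsto_add tendsto_const tendsto_p_power)
    show "\<forall>\<^sub>F N in sequentially. y + of_nat (p ^ N) \<in> padic_integers"
      by (intro always_eventually allI padic_integers_add y padic_integers_of_nat)
  qed (simp add: y)
  then have "(\<lambda>N. f y + f (y + of_nat (p ^ N))) \<longlonglongrightarrow> f y + f y"
    by (intro tendsto_add tendsto_const) simp
  ultimately have "(\<lambda>N. ?S (y + 1) N + ?S y N) \<longlonglongrightarrow> f y + f y"
    by (simp only:)
  moreover have "(\<lambda>N. ?S (y + 1) N + ?S y N)
      \<longlonglongrightarrow> fermionic_integral p (\<lambda>a. f (y + 1 + a)) + fermionic_integral p (\<lambda>a. f (y + a))"
    by (intro tendsto_add fermionic_sum_tendsto fermionic_integrable_uniformly_continuous[OF \<open>odd p\<close> f]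
        padic_integers_add y padic_integers_1)
  ultimately show ?thesis
    by (simp only: mult_2 LIMSEQ_unique)
qed

lemma fermionic_integral_iterated:
  fixes f :: "'a \<Rightarrow> 'a"
  assumes "odd p" and f: "uniformly_continuous_on padic_integers f" and x: "x \<in> padic_integers"
    and "fermionic_integrable p (\<lambda>a. (x + a) * f (x + a))"
  shows "fermionic_sum p (\<lambda>b. fermionic_integral p (\<lambda>a. f (x + b + a)))
    \<longlonglongrightarrow> 2 * (1 - x) * fermionic_integral p (\<lambda>a. f (x + a))
        + 2 * fermionic_integral p (\<lambda>a. (x + a) * f (x + a))"
proof -
  let ?I = "fermionic_integral p (\<lambda>a. f (x + a))"
  let ?J = "fermionic_integral p (\<lambda>a. (x + a) * f (x + a))"
  let ?S = "fermionic_sum p (\<lambda>a. f (x + a))" and ?T = "fermionic_sum p (\<lambda>a. (x + a) * f (x + a))"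
  define F where "F b = fermionic_integral p (\<lambda>a. f (x + of_nat b + a))" for b
  have F: "F (Suc b) + F b = 2 * f (x + of_nat b)" for b
    using fermionic_integral_shift[OF \<open>odd p\<close> f, of "x + of_nat b"] x
    by (simp add: F_def padic_integers_add add.assoc add.commute[of 1])
  \<comment> \<open>Writing \<open>a\<close> as \<open>(x + a) - x\<close> introduces the weight
    \<open>x + a\<close>; the subtracted part contributes \<open>- 2 * x\<close> to the coefficient
    of the integral of \<open>f\<close>.\<close>
  have "(\<Sum>a<p ^ N. (- 1) ^ a * (of_nat a * f (x + of_nat a))) = ?T N - x * ?S N" for N
    by (simp add: fermionic_sum_def sum_distrib_left algebra_simps flip: sum_subtractf)
  then have "fermionic_sum p (\<lambda>b. fermionic_integral p (\<lambda>a. f (x + b + a)))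
      = (\<lambda>N. of_nat (p ^ N) * ?I - 2 * (of_nat (p ^ N) - 1) * ?S N + 2 * (?T N - x * ?S N))"
    using sum_alternating_iterated[of F "\<lambda>b. f (x + of_nat b)", OF F]
    by (simp add: fermionic_sum_def F_def fun_eq_iff)
  moreover have "(\<lambda>N. of_nat (p ^ N) * ?I - 2 * (of_nat (p ^ N) - 1) * ?S N + 2 * (?T N - x * ?S N))
      \<longlonglongrightarrow> 0 * ?I - 2 * (0 - 1) * ?I + 2 * (?J - x * ?I)"
    by (intro tendsto_add tendsto_diff tendsto_mult tendsto_const tendsto_p_power fermionic_sum_tendsto
        fermionic_integrable_uniformly_continuous assms)
  moreover have "0 * ?I - 2 * (0 - 1) * ?I + 2 * (?J - x * ?I) = 2 * (1 - x) * ?I + 2 * ?J"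
    by (simp add: algebra_simps)
  ultimately show ?thesis
    by (simp only: )
qed

end

text \<open>Integrability belongs to the conclusion because the integral is a bare
  \<open>lim\<close>, whose value alone does not attest convergence.\<close>

theorem theorem4p12:
  fixes p v :: nat
    and chi :: "int \<Rightarrow> 'a::{nonarch_valued_field, complete_space}"
    and x s :: 'a
  assumes "prime p" and "odd p"
    and "padic_complex_field p TYPE('a)"
    and "v \<ge> 1" and "dirichlet_character (p ^ v) chi"
    and "x \<in> padic_integers"
    and "vabs s < zeta_radius p"
  shows "fermionic_integrable p (\<lambda>a. zeta_pE p v chi s (x + a)) \<and>
    fermionic_integral p (\<lambda>a. zeta_pE p v chi s (x + a)) =
      2 * (1 - x) * zeta_pE p v chi s x
      + 2 * zeta_pE p v (\<lambda>n. chi n * teichmueller_character p n) (s - 1) x"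
proof -
  interpret padic_field p "TYPE('a)"
    using assms(1,3) by unfold_locales (simp_all add: padic_complex_field_def)
  have "p > 2"
    using p_gt_1 \<open>odd p\<close> by (cases "p = 2") auto
  \<comment> \<open>For \<open>p > 2\<close> the exponent \<open>(p - 2) / (p - 1)\<close> is
    positive; with a radius above \<open>1\<close>, the ultrametric inequality lets the exponent of
    the series move by \<open>1\<close> without leaving the disc.\<close>
  then have radius: "1 < zeta_radius p"
    unfolding zeta_radius_def by (intro gr_one_powr) simp_all
  have t: "vabs (1 - s) < zeta_radius p"
    using vabs_diff_le[of 1 "max 1 (vabs s)" s] assms(7) radius by simp
  have t1: "vabs (1 - s + 1) < zeta_radius p"
    using vabs_add_le[of "1 - s" "max 1 (vabs (1 - s))" 1] t radius by simp
  have period: "\<forall>a. chi (a + int (p ^ v)) = chi a"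
    and zero: "\<And>a. \<not> coprime a (int p) \<Longrightarrow> chi a = 0"
    using assms(4,5) by (auto simp: dirichlet_character_def)
  let ?psi = "\<lambda>n. chi n * teichmueller_character p n"
  let ?f = "\<lambda>y. character_extension (p ^ v) chi y * padic_angle_power p y (1 - s)"
  \<comment> \<open>The exponent \<open>1 - (s - 1)\<close> is written as \<open>1 - s + 1\<close>
    to fit the shift rule for the series.\<close>
  let ?g = "\<lambda>y. character_extension (p ^ v) ?psi y * padic_angle_power p y (1 - s + 1)"
  have f: "uniformly_continuous_on padic_integers ?f"
    by (rule uniformly_continuous_zeta_integrand[OF t radius \<open>v \<ge> 1\<close> period zero])
  have g: "uniformly_continuous_on padic_integers ?g"
    using character_extension_mult_teichmueller(1)[OF \<open>v \<ge> 1\<close> assms(6) period] zero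
    by (intro uniformly_continuous_zeta_integrand[OF t1 radius \<open>v \<ge> 1\<close>]) simp_all
  have fg: "?g y = y * ?f y" if y: "y \<in> padic_integers" for y
  proof (cases "vabs y = 1")
    case True
    then show ?thesis
      using padic_angle_power_add_1[OF t radius y]
      by (simp add: character_extension_mult_teichmueller(2)[OF \<open>v \<ge> 1\<close> y period] mult.assoc mult.left_commute)
  next
    \<comment> \<open>A non-unit is approximated by an integer divisible by \<open>p\<close>, where
      \<open>chi\<close> vanishes, so both sides are \<open>0\<close>.\<close>
    case False
    obtain n where n: "vabs (y - of_int n) \<le> 1 / real p ^ v"
      using padic_integers_approx[OF y] .
    then have "vabs (of_int n :: 'a) \<noteq> 1"
      using inverse_p_power_le[OF \<open>v \<ge> 1\<close>] False vabs_eq_1_cong[of y "of_int n"] by simp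
    then have "chi n = 0"
      using vabs_of_int_coprime zero by blast
    then show ?thesis
      using character_extension_eq[OF period y n]
      by (simp add: character_extension_mult_teichmueller(2)[OF \<open>v \<ge> 1\<close> y period])
  qed
  \<comment> \<open>The sums evaluate only at \<open>x + a\<close> with \<open>a\<close> natural,
    which are p-adic integers, so \<open>fg\<close> applies to every term.\<close>
  have "fermionic_sum p (\<lambda>a. ?g (x + a)) = fermionic_sum p (\<lambda>a. (x + a) * ?f (x + a))"
    unfolding fermionic_sum_def
    by (intro ext sum.cong refl) (simp only: fg padic_integers_add assms(6) padic_integers_of_nat)
  then have int_eq: "fermionic_integrable p (\<lambda>a. ?g (x + a)) = fermionic_integrable p (\<lambda>a. (x + a) * ?f (x + a))"
    "fermionic_integral p (\<lambda>a. ?g (x + a)) = fermionic_integral p (\<lambda>a. (x + a) * ?f (x + a))"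
    by (simp_all only: fermionic_integrable_def fermionic_integral_def)
  have zeta: "zeta_pE p v chi s y = fermionic_integral p (\<lambda>a. ?f (y + a))"
    "zeta_pE p v ?psi (s - 1) y = fermionic_integral p (\<lambda>a. ?g (y + a))" for y
    by (simp_all add: zeta_pE_def algebra_simps)
  have "fermionic_integrable p (\<lambda>a. ?g (x + a))"
    using \<open>odd p\<close> g assms(6) by (rule fermionic_integrable_uniformly_continuous)
  then have "fermionic_sum p (\<lambda>b. fermionic_integral p (\<lambda>a. ?f (x + b + a)))
    \<longlonglongrightarrow> 2 * (1 - x) * fermionic_integral p (\<lambda>a. ?f (x + a)) + 2 * fermionic_integral p (\<lambda>a. ?g (x + a))"
    unfolding int_eq by (rule fermionic_integral_iterated[OF \<open>odd p\<close> f assms(6)])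
  then show ?thesis
    unfolding zeta by (blast intro: fermionic_integralI)
qed

end
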